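(* Let $W_3(n)$ be the number of $3$-stack-sortable permutations in $S_n$. Then $\lim_{n\to\infty}W_3(n)^{1/n}$ exists and \[\lim_{n\to\infty}W_3(n)^{1/n}\ge 8.659702.\]
   Context: $S_n$ is the set of permutations of $\{1,\dots,n\}$. The stack-sorting map $s$: given an input permutation, repeatedly: if the stack is empty or the next input entry is smaller than the top of the stack, push the next input entry; otherwise pop the top of the stack to the end of the output. $s(\pi)$ is the final output. A permutation $\pi$ is $3$-stack-sortable if $s(s(s(\pi)))$ is increasing. *)

theory Defs
  imports "HOL-Combinatorics.Multiset_Permutations"
begin

text \<open>
  Permutations of \<open>{1..n}\<close> are in one-line notation: elements of
  \<^term>\<open>permutations_of_set {1..n::nat}\<close>.

  The arguments of \<open>stack_run\<close> are the remaining input and the current stack, with the top of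
  the stack at the head of the list; the result is the output still to be written, leftmost
  entry first. When the input is exhausted there is no next entry to push, so the stack is popped
  until it is empty.
\<close>

fun stack_run :: "nat list \<Rightarrow> nat list \<Rightarrow> nat list" where
  "stack_run [] [] = []"
| "stack_run [] (t # ts) = t # stack_run [] ts"
| "stack_run (x # xs) [] = stack_run xs [x]"
| "stack_run (x # xs) (t # ts) =
     (if x < t then stack_run xs (x # t # ts) else t # stack_run (x # xs) ts)"

definition stack_sort :: "nat list \<Rightarrow> nat list" where
  "stack_sort p = stack_run p []"

definition three_stack_sortable :: "nat list \<Rightarrow> bool" where
  "three_stack_sortable p \<longleftrightarrow> sorted_wrt (<) (stack_sort (stack_sort (stack_sort p)))"

definition W3 :: "nat \<Rightarrow> nat" where
  "W3 n = card {p \<in> permutations_of_set {1..n}. three_stack_sortable p}"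

end

theory Submission
  imports Defs Complex_Main
begin

text \<open>
  Write \<open>f(q, n)\<close> for the number of preimages under \<open>s\<close> of \<open>q\<close> followed by \<open>n\<close> increasing entries
  larger than all of \<open>q\<close>. If \<open>q = L m R\<close> with \<open>m\<close> the maximum, then \<open>f(q, n) = f(L, n + 1)\<close> for
  empty \<open>R\<close>, and otherwise \<open>f(q, n)\<close> is the sum of \<open>f(L, n - j) f(R, j)\<close> over \<open>j < n\<close>.
  The permutation \<open>q\<close> is 2-stack-sortable iff \<open>L\<close> and \<open>R\<close> are, all of \<open>L\<close> except its maximum \<open>x\<close> lies
  below \<open>R\<close>, and the value of \<open>x\<close> falls between two consecutive sum components of \<open>s(R)\<close> (or before
  the first, or after the last). So 2-stack-sortable permutations are encoded by binary trees with a
  number at each node that selects the position of \<open>x\<close>, and \<open>W3(n)\<close> is at least the sum of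
  \<open>f(q, 0)\<close> over these trees.

  Let \<open>g(p, n)\<close> be the generating function in \<open>z\<close> of \<open>f(q, n)\<close>, where \<open>q\<close> has weight \<open>1\<close>,
  \<open>c\<close> or \<open>c (c + 1) / 2\<close> for \<open>p = 0, 1, 2\<close> and \<open>c\<close> is the number of sum components of \<open>s(q)\<close>.
  The recursion turns into a quadratic system of inequalities with nonnegative coefficients for \<open>g\<close>.
  If the limit were smaller than 8.659702, then \<open>g\<close> would be finite at \<open>z = 3 / 26\<close>. Iterating the
  system from zero, with \<open>n \<le> 10\<close> and rounding down, gives lower bounds for \<open>g\<close> which after finitely
  many steps reach a point where the linearization is expanding, so \<open>g\<close> cannot be finite.
  The limit exists since \<open>W3\<close> is supermultiplicative and at most exponential.
\<close>

section \<open>Preimages under the stack-sorting map\<close>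

lemma stack_run_Nil [simp]: "stack_run [] ts = ts"
  by (induction ts) auto

lemma stack_sort_Nil [simp]: "stack_sort [] = []"
  by (simp add: stack_sort_def)

lemma mset_stack_run: "mset (stack_run xs ts) = mset xs + mset ts"
  by (induction xs ts rule: stack_run.induct) auto

lemma mset_stack_sort [simp]: "mset (stack_sort xs) = mset xs"
  by (simp add: stack_sort_def mset_stack_run)

lemma set_stack_sort [simp]: "set (stack_sort xs) = set xs"
  by (rule mset_eq_setD) simp

lemma length_stack_sort [simp]: "length (stack_sort xs) = length xs"
  by (rule mset_eq_length) simp

lemma distinct_stack_sort [simp]: "distinct (stack_sort xs) = distinct xs"
  by (rule mset_eq_imp_distinct_iff) simp

text \<open>Before a dominating \<open>b\<close> can be pushed, everything on the stack is popped,
  so the run restarts at \<open>b\<close> with an empty stack.\<close>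

lemma stack_run_append_greater:
  assumes "\<forall>a\<in>set xs \<union> set ts. a < b"
  shows "stack_run (xs @ b # ys) ts = stack_run xs ts @ stack_run (b # ys) []"
  using assms
proof (induction xs ts rule: stack_run.induct)
  case (2 t ts)
  then show ?case by (cases ts) auto
qed auto

lemma stack_run_bottom:
  assumes "\<forall>a\<in>set xs. a < b"
  shows "stack_run xs (ts @ [b]) = stack_run xs ts @ [b]"
  using assms by (induction xs ts rule: stack_run.induct) auto

text \<open>On arrival \<open>b\<close> clears the stack, and it stays at the bottom while
  \<open>ys\<close> is processed above it. This is the usual recursion for s, through which s is
  accessed from here on.\<close>

lemma stack_sort_max:
  assumes "\<forall>a\<in>set xs \<union> set ys. a < b"
  shows "stack_sort (xs @ b # ys) = stack_sort xs @ stack_sort ys @ [b]"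
  using assms stack_run_append_greater[of xs "[]" b ys] stack_run_bottom[of ys b "[]"]
  by (simp add: stack_sort_def)

lemma stack_sort_snoc:
  assumes "\<forall>a\<in>set xs. a < b"
  shows "stack_sort (xs @ [b]) = stack_sort xs @ [b]"
  using stack_sort_max[of xs "[]" b] assms by simp

text \<open>The first entry of \<open>ys\<close> exceeds everything in \<open>xs\<close> and clears
  the stack.\<close>

lemma stack_sort_append:
  assumes "\<And>a b. a \<in> set xs \<Longrightarrow> b \<in> set ys \<Longrightarrow> a < b"
  shows "stack_sort (xs @ ys) = stack_sort xs @ stack_sort ys"
  using assms stack_run_append_greater[of xs "[]" "hd ys" "tl ys"]
  by (cases ys) (auto simp: stack_sort_def)

lemma stack_run_map:
  assumes "strict_mono_on (set xs \<union> set ts) h"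
  shows "stack_run (map h xs) (map h ts) = map h (stack_run xs ts)"
  using assms
proof (induction xs ts rule: stack_run.induct)
  case (3 x xs)
  then show ?case by (auto simp: strict_mono_on_def)
next
  case (4 x xs t ts)
  have "h x < h t \<longleftrightarrow> x < t"
    using 4(3) strict_mono_on_less by (metis Un_iff list.set_intros(1))
  moreover have "strict_mono_on (set xs \<union> set (x # t # ts)) h"
      "strict_mono_on (set (x # xs) \<union> set ts) h"
    using 4(3) by (rule monotone_on_subset, auto)+
  ultimately show ?case using 4(1,2) by auto
qed auto

lemma stack_sort_map:
  assumes "strict_mono_on (set xs) h"
  shows "stack_sort (map h xs) = map h (stack_sort xs)"
  using stack_run_map[of xs "[]" h] assms by (simp add: stack_sort_def)

section \<open>Number of preimages\<close>

definition fertility :: "nat list \<Rightarrow> nat" where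
  "fertility q = card {p. stack_sort p = q}"

lemma finite_stack_sort_vimage [simp]: "finite {p. stack_sort p = q}"
proof (rule finite_subset)
  show "{p. stack_sort p = q} \<subseteq> {p. set p \<subseteq> set q \<and> length p = length q}"
    by auto
qed (simp add: finite_lists_length_eq)

lemma stack_sort_eq_Nil [simp]: "stack_sort p = [] \<longleftrightarrow> p = []"
  by (metis length_0_conv length_stack_sort)

lemma fertility_Nil [simp]: "fertility [] = 1"
  by (simp add: fertility_def)

lemma split_at_Max:
  fixes p :: "'a::linorder list"
  assumes "p \<noteq> []" "distinct p"
  obtains xs b ys where "p = xs @ b # ys" "\<forall>a\<in>set xs \<union> set ys. a < b"
proof -
  have "Max (set p) \<in> set p" using assms by auto
  then obtain xs ys where p: "p = xs @ Max (set p) # ys"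
    by (meson split_list)
  have "\<forall>a\<in>set xs \<union> set ys. a < Max (set p)"
  proof
    fix a assume a: "a \<in> set xs \<union> set ys"
    then have "a \<in> set p" by (subst p) auto
    then have "a \<le> Max (set p)" by simp
    moreover have "a \<noteq> Max (set p)"
    proof -
      have "distinct (xs @ Max (set p) # ys)" using assms(2) p by metis
      then show ?thesis using a by auto
    qed
    ultimately show "a < Max (set p)" by simp
  qed
  with p that show ?thesis by blast
qed

text \<open>A preimage has the form \<open>xs @ b # ys\<close>, where the images of
  \<open>xs\<close> and \<open>ys\<close> concatenate to \<open>q\<close>. The position of
  \<open>b\<close> recovers the split point, so the pieces are disjoint.\<close>

lemma fertility_snoc:
  assumes "\<forall>a\<in>set q. a < b"
  shows "fertility (q @ [b]) = (\<Sum>k\<le>length q. fertility (take k q) * fertility (drop k q))"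
proof -
  let ?S = "\<lambda>q. {p. stack_sort p = q}"
  let ?I = "\<lambda>k. (\<lambda>(xs, ys). xs @ b # ys) ` (?S (take k q) \<times> ?S (drop k q))"
  have sub: "set xs \<subseteq> set q" "length xs = min (length q) k" if "stack_sort xs = take k q" for xs k
    using arg_cong[OF that, of set] arg_cong[OF that, of length] set_take_subset[of k q] by simp_all
  have sub': "set ys \<subseteq> set q" if "stack_sort ys = drop k q" for ys k
    using arg_cong[OF that, of set] set_drop_subset[of k q] by simp
  have "?S (q @ [b]) = (\<Union>k\<le>length q. ?I k)"
  proof (intro equalityI subsetI)
    fix p assume "p \<in> ?S (q @ [b])"
    then have p: "stack_sort p = q @ [b]" by simp
    then have m: "mset p = mset q + {#b#}"
      using mset_stack_sort[of p] by simp
    have "set p = insert b (set q)" using p set_stack_sort[of p] by simp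
    then have "b \<in> set p" by simp
    then obtain xs ys where xy: "p = xs @ b # ys" by (meson split_list)
    then have "mset q = mset xs + mset ys" using m by simp
    then have "set_mset (mset q) = set_mset (mset xs + mset ys)" by simp
    then have "set q = set xs \<union> set ys" by simp
    then have "stack_sort p = stack_sort xs @ stack_sort ys @ [b]"
      using xy assms by (simp add: stack_sort_max)
    then have "q = stack_sort xs @ stack_sort ys" using p by simp
    then show "p \<in> (\<Union>k\<le>length q. ?I k)"
      by (intro UN_I[of "length xs"]) (auto simp: xy)
  next
    fix p assume "p \<in> (\<Union>k\<le>length q. ?I k)"
    then obtain k xs ys where p: "p = xs @ b # ys" and xy: "stack_sort xs = take k q" "stack_sort ys = drop k q"
      by auto
    have "\<forall>a\<in>set xs \<union> set ys. a < b"
      using sub(1)[OF xy(1)] sub'[OF xy(2)] assms by auto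
    then show "p \<in> ?S (q @ [b])" using xy by (simp add: p stack_sort_max)
  qed
  then have "fertility (q @ [b]) = card (\<Union>k\<le>length q. ?I k)"
    by (simp add: fertility_def)
  also have "\<dots> = (\<Sum>k\<le>length q. card (?I k))"
  proof (rule card_UN_disjoint)
    show "\<forall>k\<in>{..length q}. \<forall>k'\<in>{..length q}. k \<noteq> k' \<longrightarrow> ?I k \<inter> ?I k' = {}"
    proof (intro ballI impI, rule ccontr)
      fix k k' assume k: "k \<in> {..length q}" "k' \<in> {..length q}" "k \<noteq> k'" "?I k \<inter> ?I k' \<noteq> {}"
      then obtain xs ys xs' ys' where e: "xs @ b # ys = xs' @ b # ys'"
        and x: "stack_sort xs = take k q" "stack_sort xs' = take k' q"
        and y: "stack_sort ys = drop k q"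
        by auto
      have "b \<notin> set xs" "b \<notin> set ys"
        using sub(1)[OF x(1)] sub'[OF y] assms by auto
      then have "xs = xs'" using e append_Cons_eq_iff[of b xs ys xs' ys'] by simp
      then show False using sub(2)[OF x(1)] sub(2)[OF x(2)] k by auto
    qed
  qed auto
  also have "\<dots> = (\<Sum>k\<le>length q. fertility (take k q) * fertility (drop k q))"
  proof (rule sum.cong[OF refl])
    fix k assume "k \<in> {..length q}"
    have "inj_on (\<lambda>(xs, ys). xs @ b # ys) (?S (take k q) \<times> ?S (drop k q))"
      by (auto simp: inj_on_def dest!: sub(2))
    then show "card (?I k) = fertility (take k q) * fertility (drop k q)"
      by (simp add: card_image card_cartesian_product fertility_def)
  qed
  finally show ?thesis .
qed

text \<open>The image of a nonempty list with distinct entries ends with its maximum.\<close>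

lemma fertility_eq_0:
  assumes "distinct (q @ [b])" "a \<in> set q" "b < a"
  shows "fertility (q @ [b]) = 0"
proof -
  have "stack_sort p \<noteq> q @ [b]" for p
  proof
    assume p: "stack_sort p = q @ [b]"
    then have "p \<noteq> []" "distinct p" using assms(1) distinct_stack_sort[of p] by auto
    then obtain xs c ys where c: "p = xs @ c # ys" "\<forall>a\<in>set xs \<union> set ys. a < c"
      by (rule split_at_Max)
    then have "b = c" using p stack_sort_max[OF c(2)] by auto
    have "a \<in> set p" using p assms(2) set_stack_sort[of p] by auto
    then show False using c \<open>b = c\<close> assms(3) by (auto dest!: less_not_sym)
  qed
  then show ?thesis by (simp add: fertility_def)
qed

fun catalan :: "nat \<Rightarrow> nat" where
  "catalan 0 = 1"
| "catalan (Suc n) = (\<Sum>k\<le>n. catalan k * catalan (n - k))"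

lemma fertility_sorted:
  assumes "sorted_wrt (<) q"
  shows "fertility q = catalan (length q)"
  using assms
proof (induction "length q" arbitrary: q rule: less_induct)
  case less
  show ?case
  proof (cases q rule: rev_exhaust)
    case Nil
    then show ?thesis by simp
  next
    case (snoc r b)
    have r: "sorted_wrt (<) r" "\<forall>a\<in>set r. a < b"
      using less.prems snoc by (auto simp: sorted_wrt_append)
    have "fertility (take k r) = catalan k" "fertility (drop k r) = catalan (length r - k)"
      if "k \<le> length r" for k
      using that less.hyps[of "take k r"] less.hyps[of "drop k r"] r(1) snoc
      by (auto simp: sorted_wrt_take sorted_wrt_drop)
    then show ?thesis
      using r(2) by (simp add: snoc fertility_snoc)
  qed
qed

text \<open>The split exactly between \<open>xs\<close> and \<open>ys\<close> is counted in the
  second sum, hence the strict bound in the first.\<close>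

lemma sum_splits_append:
  fixes g :: "'a list \<Rightarrow> 'a list \<Rightarrow> 'b::comm_monoid_add"
  shows "(\<Sum>k\<le>length (xs @ ys). g (take k (xs @ ys)) (drop k (xs @ ys))) =
    (\<Sum>k<length xs. g (take k xs) (drop k xs @ ys)) +
    (\<Sum>k\<le>length ys. g (xs @ take k ys) (drop k ys))"
proof -
  have "{..length (xs @ ys)} = {..<length xs} \<union> (+) (length xs) ` {..length ys}"
  proof (intro equalityI subsetI)
    fix k assume "k \<in> {..length (xs @ ys)}"
    then have "k < length xs \<or> k = length xs + (k - length xs) \<and> k - length xs \<le> length ys"
      by auto
    then show "k \<in> {..<length xs} \<union> (+) (length xs) ` {..length ys}" by blast
  qed auto
  then have "(\<Sum>k\<le>length (xs @ ys). g (take k (xs @ ys)) (drop k (xs @ ys))) =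
      (\<Sum>k<length xs. g (take k (xs @ ys)) (drop k (xs @ ys))) +
      (\<Sum>k\<in>(+) (length xs) ` {..length ys}. g (take k (xs @ ys)) (drop k (xs @ ys)))"
    by (simp only:, subst sum.union_disjoint) auto
  then show ?thesis by (simp add: sum.reindex)
qed

text \<open>
  In terms of decreasing binary trees with postorder \<open>ls m rs ts\<close>: the entry after \<open>m\<close> is smaller
  than \<open>m\<close>, so \<open>m\<close> is a left child. Its parent is some \<open>ts ! j\<close>, whose right subtree has postorder
  \<open>rs @ take j ts\<close>; contracting the parent and this subtree leaves a tree for the first factor.
\<close>

lemma fertility_append_tail:
  assumes "sorted_wrt (<) ts" "distinct (ls @ m # rs @ ts)" "rs \<noteq> []"
    and "\<And>r. r \<in> set rs \<Longrightarrow> r < m"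
    and "\<And>x t. x \<in> set (ls @ m # rs) \<Longrightarrow> t \<in> set ts \<Longrightarrow> x < t"
  shows "fertility (ls @ m # rs @ ts) =
    (\<Sum>j<length ts. fertility (ls @ m # drop (Suc j) ts) * fertility (rs @ take j ts))"
  using assms
proof (induction "length ts" arbitrary: ts ls rule: less_induct)
  case less
  \<comment> \<open>A nonempty prefix of \<open>rs\<close> after \<open>m\<close> puts an entry
    smaller than \<open>m\<close> last, so there is no preimage.\<close>
  have zero: "fertility (ls' @ m # rs1) = 0"
    if "rs1 = take (Suc k) rs" "set ls' \<subseteq> set ls" "distinct ls'" for ls' rs1 k
  proof -
    have "rs1 \<noteq> []" using that less.prems(3) by simp
    then obtain rs2 r where r: "rs1 = rs2 @ [r]" by (meson rev_exhaust)
    have sub: "set rs1 \<subseteq> set rs" using that(1) by (simp add: set_take_subset)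
    have "distinct rs1" using that(1) less.prems(2) by simp
    then have "distinct ((ls' @ m # rs2) @ [r])"
      using less.prems(2) that sub r by auto
    moreover have "r < m" using less.prems(4) sub r by auto
    ultimately show ?thesis
      using fertility_eq_0[of "ls' @ m # rs2" r m] r by simp
  qed
  show ?case
  proof (cases ts rule: rev_exhaust)
    case Nil
    then show ?thesis using zero[of rs "length rs" ls] less.prems(2) by simp
  next
    case (snoc us t)
    let ?n = "length us"
    \<comment> \<open>The last entry \<open>t\<close> of the tail is removed by
      \<open>fertility_snoc\<close>. \<open>P i\<close> collects the splits before \<open>m\<close>,
      \<open>Q i k\<close> is the split after \<open>m\<close> that cuts \<open>us\<close> at
      \<open>k\<close>, and \<open>R j\<close> is the factor of \<open>rs\<close>.\<close>
    define P where "P = (\<lambda>i. \<Sum>k\<le>length ls. fertility (take k ls) * fertility (drop k ls @ m # drop i us))"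
    define Q where "Q = (\<lambda>i k. fertility (ls @ m # drop i (take k us)) * fertility (drop k us))"
    define R where "R = (\<lambda>j. fertility (rs @ take j us))"
    have us: "sorted_wrt (<) us" using less.prems(1) snoc by (simp add: sorted_wrt_append)
    have lt: "x < t" if "x \<in> set (ls @ m # rs @ us)" for x
      using that less.prems(1,5) snoc by (auto simp: sorted_wrt_append)
    have IH: "fertility (ls' @ m # rs @ take k us) =
        (\<Sum>j<k. fertility (ls' @ m # drop (Suc j) (take k us)) * R j)"
      if "k \<le> ?n" "set ls' \<subseteq> set ls" "distinct ls'" for k ls'
    proof -
      have "fertility (ls' @ m # rs @ take k us) = (\<Sum>j<length (take k us).
          fertility (ls' @ m # drop (Suc j) (take k us)) * fertility (rs @ take j (take k us)))"
      proof (rule less.hyps)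
        show "length (take k us) < length ts" using snoc that by simp
        show "sorted_wrt (<) (take k us)" using us by (rule sorted_wrt_take)
        show "distinct (ls' @ m # rs @ take k us)"
          using less.prems(2) snoc that set_take_subset[of k us] by auto
        show "x < t" if "x \<in> set (ls' @ m # rs)" "t \<in> set (take k us)" for x t
          using that less.prems(5)[of x t] snoc \<open>set ls' \<subseteq> set ls\<close> set_take_subset[of k us] by auto
      qed (use less.prems in auto)
      also have "\<dots> = (\<Sum>j<k. fertility (ls' @ m # drop (Suc j) (take k us)) * R j)"
        using that by (intro sum.cong) (auto simp: R_def min_def)
      finally show ?thesis .
    qed
    \<comment> \<open>The first factors on the right-hand side of the claim still end in
      \<open>t\<close> for \<open>j < length us\<close>; this expands them in the same way.\<close>
    have expand: "fertility (ls @ m # drop i us @ [t]) = P i + (\<Sum>k\<in>{i..?n}. Q i k)" if "i \<le> ?n" for i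
    proof -
      have "fertility ((ls @ m # drop i us) @ [t]) =
        (\<Sum>k\<le>length ((ls @ [m]) @ drop i us). fertility (take k ((ls @ [m]) @ drop i us)) *
           fertility (drop k ((ls @ [m]) @ drop i us)))"
        using lt set_drop_subset[of i us] by (subst fertility_snoc) auto
      also have "\<dots> = (\<Sum>k<length (ls @ [m]). fertility (take k (ls @ [m])) *
            fertility (drop k (ls @ [m]) @ drop i us)) +
          (\<Sum>k\<le>length (drop i us). fertility ((ls @ [m]) @ take k (drop i us)) * fertility (drop k (drop i us)))"
        by (rule sum_splits_append)
      also have "(\<Sum>k<length (ls @ [m]). fertility (take k (ls @ [m])) *
            fertility (drop k (ls @ [m]) @ drop i us)) = P i"
        unfolding P_def by (intro sum.cong) auto
      also have "(\<Sum>k\<le>length (drop i us). fertility ((ls @ [m]) @ take k (drop i us)) *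
          fertility (drop k (drop i us))) = (\<Sum>k\<in>{i..?n}. Q i k)"
        unfolding Q_def using that
        by (intro sum.reindex_bij_witness[of _ "\<lambda>k. k - i" "\<lambda>k. k + i"])
           (auto simp: drop_take add.commute)
      finally show ?thesis by simp
    qed
    have "fertility (ls @ m # rs @ ts) =
        (\<Sum>k\<le>length ((ls @ [m]) @ rs @ us). fertility (take k ((ls @ [m]) @ rs @ us)) *
          fertility (drop k ((ls @ [m]) @ rs @ us)))"
      using lt fertility_snoc[of "ls @ m # rs @ us" t] by (simp add: snoc)
    also have "\<dots> = (\<Sum>k<length (ls @ [m]). fertility (take k (ls @ [m])) *
          fertility (drop k (ls @ [m]) @ rs @ us)) +
        (\<Sum>k\<le>length (rs @ us). fertility ((ls @ [m]) @ take k (rs @ us)) * fertility (drop k (rs @ us)))"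
      by (rule sum_splits_append)
    also have "(\<Sum>k<length (ls @ [m]). fertility (take k (ls @ [m])) *
          fertility (drop k (ls @ [m]) @ rs @ us)) =
        (\<Sum>k\<le>length ls. fertility (take k ls) * fertility (drop k ls @ m # rs @ us))"
      by (intro sum.cong) auto
    also have "\<dots> = (\<Sum>k\<le>length ls. \<Sum>j<?n. fertility (take k ls) *
          (fertility (drop k ls @ m # drop (Suc j) us) * R j))"
    proof (rule sum.cong[OF refl])
      fix k
      have "fertility (drop k ls @ m # rs @ us) = (\<Sum>j<?n. fertility (drop k ls @ m # drop (Suc j) us) * R j)"
        using IH[of ?n "drop k ls"] less.prems(2) set_drop_subset[of k ls] by simp
      then show "fertility (take k ls) * fertility (drop k ls @ m # rs @ us) =
          (\<Sum>j<?n. fertility (take k ls) * (fertility (drop k ls @ m # drop (Suc j) us) * R j))"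
        by (simp add: sum_distrib_left)
    qed
    also have "\<dots> = (\<Sum>j<?n. P (Suc j) * R j)"
      unfolding P_def by (subst sum.swap) (simp add: sum_distrib_right mult.assoc)
    also have "(\<Sum>k\<le>length (rs @ us). fertility ((ls @ [m]) @ take k (rs @ us)) * fertility (drop k (rs @ us))) =
        (\<Sum>k<length rs. fertility ((ls @ [m]) @ take k rs) * fertility (drop k rs @ us)) +
        (\<Sum>k\<le>?n. fertility ((ls @ [m]) @ rs @ take k us) * fertility (drop k us))"
      by (subst sum_splits_append[where g = "\<lambda>a b. fertility ((ls @ [m]) @ a) * fertility b"]) simp
    \<comment> \<open>Of the splits inside \<open>rs\<close> only the one immediately after
      \<open>m\<close> survives; it supplies the summand \<open>j = length us\<close> of the
      claim.\<close>
    also have "(\<Sum>k<length rs. fertility ((ls @ [m]) @ take k rs) * fertility (drop k rs @ us)) =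
        (\<Sum>k<length rs. if k = 0 then fertility (ls @ [m]) * R ?n else 0)"
    proof (rule sum.cong[OF refl])
      fix k assume "k \<in> {..<length rs}"
      show "fertility ((ls @ [m]) @ take k rs) * fertility (drop k rs @ us) =
          (if k = 0 then fertility (ls @ [m]) * R ?n else 0)"
        using zero[of "take k rs" "k - 1" ls] less.prems(2) by (cases k) (auto simp: R_def)
    qed
    also have "\<dots> = fertility (ls @ [m]) * R ?n"
      using less.prems(3) by simp
    also have "(\<Sum>k\<le>?n. fertility ((ls @ [m]) @ rs @ take k us) * fertility (drop k us)) =
        (\<Sum>k\<le>?n. \<Sum>j<k. Q (Suc j) k * R j)"
    proof (rule sum.cong[OF refl])
      fix k assume "k \<in> {..?n}"
      then show "fertility ((ls @ [m]) @ rs @ take k us) * fertility (drop k us) = (\<Sum>j<k. Q (Suc j) k * R j)"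
        using IH[of k ls] less.prems(2)
        by (simp add: Q_def sum_distrib_left sum_distrib_right algebra_simps)
    qed
    also have "\<dots> = (\<Sum>j<?n. \<Sum>k\<in>{Suc j..?n}. Q (Suc j) k * R j)"
    proof -
      have "(\<Sum>k\<le>?n. \<Sum>j<k. Q (Suc j) k * R j) = (\<Sum>(k, j)\<in>(SIGMA k:{..?n}. {..<k}). Q (Suc j) k * R j)"
        by (simp add: sum.Sigma)
      also have "\<dots> = (\<Sum>(j, k)\<in>(SIGMA j:{..<?n}. {Suc j..?n}). Q (Suc j) k * R j)"
        by (rule sum.reindex_bij_witness[of _ prod.swap prod.swap]) auto
      finally show ?thesis by (simp add: sum.Sigma)
    qed
    finally have "fertility (ls @ m # rs @ ts) =
        (\<Sum>j<?n. (P (Suc j) + (\<Sum>k\<in>{Suc j..?n}. Q (Suc j) k)) * R j) + fertility (ls @ [m]) * R ?n"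
      by (simp add: sum.distrib sum_distrib_right add_mult_distrib)
    also have "(\<Sum>j<?n. (P (Suc j) + (\<Sum>k\<in>{Suc j..?n}. Q (Suc j) k)) * R j) =
        (\<Sum>j<?n. fertility (ls @ m # drop (Suc j) ts) * fertility (rs @ take j ts))"
      by (intro sum.cong) (auto simp: expand R_def snoc)
    finally show ?thesis by (simp add: snoc R_def)
  qed
qed

section \<open>A tree encoding of 2-stack-sortable permutations\<close>

datatype dtree = Leaf | Node dtree dtree nat

fun nodes :: "dtree \<Rightarrow> nat" where
  "nodes Leaf = 0"
| "nodes (Node l r i) = Suc (nodes l + nodes r)"

text \<open>
  \<open>cuts t\<close> lists the positions at which \<open>s\<close> of the encoded permutation splits into a direct sum, in
  increasing order. The label \<open>i\<close> of a node says that the maximum of the left part is placed,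
  by value, at the \<open>i\<close>-th cut of the right part.
\<close>

fun cuts :: "dtree \<Rightarrow> nat list" where
  "cuts Leaf = [0]"
| "cuts (Node l r i) =
     butlast (cuts l) @ map ((+) (nodes l)) (drop i (cuts r)) @ [Suc (nodes l + nodes r)]"

fun valid :: "dtree \<Rightarrow> bool" where
  "valid Leaf \<longleftrightarrow> True"
| "valid (Node l r i) \<longleftrightarrow> valid l \<and> valid r \<and> i < length (cuts r) \<and> (l = Leaf \<longrightarrow> i = 0)"

text \<open>Values are counted from 0. Only the maximum of the left part is moved up, past the
  \<open>v\<close> smallest entries of the right part; in \<open>right_label\<close> these are
  therefore shifted by one less than the others.\<close>

definition left_label :: "nat \<Rightarrow> nat \<Rightarrow> nat \<Rightarrow> nat" where
  "left_label k v y = (if Suc y < k then y else y + v)"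

definition right_label :: "nat \<Rightarrow> nat \<Rightarrow> nat \<Rightarrow> nat" where
  "right_label k v y = (if y < v then (k - 1) + y else k + y)"

fun perm_of :: "dtree \<Rightarrow> nat list" where
  "perm_of Leaf = []"
| "perm_of (Node l r i) =
     map (left_label (nodes l) (cuts r ! i)) (perm_of l) @
     (nodes l + nodes r) # map (right_label (nodes l) (cuts r ! i)) (perm_of r)"

lemma length_perm_of [simp]: "length (perm_of t) = nodes t"
  by (induction t) auto

lemma nodes_eq_0 [simp]: "nodes t = 0 \<longleftrightarrow> t = Leaf"
  by (cases t) auto

lemma left_label_mono: "strict_mono_on {..<k} (left_label k v)"
  by (auto simp: strict_mono_on_def left_label_def)

lemma right_label_mono: "k = 0 \<longrightarrow> v = 0 \<Longrightarrow> strict_mono_on A (right_label k v)"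
  by (auto simp: strict_mono_on_def right_label_def)

lemma left_label_image:
  assumes "k > 0"
  shows "left_label k v ` {..<k} = insert (k - 1 + v) {..<k - 1}"
proof -
  have "{..<k} = insert (k - 1) {..<k - 1}" using assms by auto
  moreover have "left_label k v ` {..<k - 1} = id ` {..<k - 1}"
    by (intro image_cong) (auto simp: left_label_def)
  ultimately show ?thesis using assms by (auto simp: left_label_def)
qed

text \<open>In order of value come the left part without its maximum, \<open>v\<close> entries of
  the right part, that maximum, and the rest of the right part. For \<open>k = 0\<close> there is no
  maximum to move, so \<open>v\<close> must be 0.\<close>

lemma label_images:
  assumes "v \<le> u" "k = 0 \<longrightarrow> v = 0"
  shows "left_label k v ` {..<k} \<union> right_label k v ` {..<u} = {..<k + u}"
proof (intro equalityI subsetI)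
  fix y assume y: "y \<in> {..<k + u}"
  consider "y < k - 1" | "y = k - 1 + v" "k > 0" | "k - 1 \<le> y" "y < k - 1 + v" | "k + v \<le> y"
    by linarith
  then show "y \<in> left_label k v ` {..<k} \<union> right_label k v ` {..<u}"
  proof cases
    case 1
    then show ?thesis by (intro UnI1 image_eqI[of _ _ y]) (auto simp: left_label_def)
  next
    case 2
    then show ?thesis by (intro UnI1 image_eqI[of _ _ "k - 1"]) (auto simp: left_label_def)
  next
    case 3
    then show ?thesis using assms y
      by (intro UnI2 image_eqI[of _ _ "y - (k - 1)"]) (auto simp: right_label_def)
  next
    case 4
    then show ?thesis using y
      by (intro UnI2 image_eqI[of _ _ "y - k"]) (auto simp: right_label_def)
  qed
qed (use assms in \<open>auto simp: left_label_def right_label_def split: if_splits\<close>)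

lemma cuts_not_Nil [simp]: "cuts t \<noteq> []"
  by (cases t) auto

lemma cuts_sorted:
  assumes "valid t"
  shows "sorted_wrt (<) (cuts t) \<and> hd (cuts t) = 0 \<and> last (cuts t) = nodes t"
  using assms
proof (induction t)
  case (Node l r i)
  let ?b = "butlast (cuts l)"
  have l: "cuts l = ?b @ [nodes l]" and r: "cuts r = butlast (cuts r) @ [nodes r]"
    using Node by (metis append_butlast_last_id cuts_not_Nil valid.simps(2))+
  have "sorted_wrt (<) (?b @ [nodes l])" "sorted_wrt (<) (butlast (cuts r) @ [nodes r])"
    using Node l r by (metis valid.simps(2))+
  then have bl: "sorted_wrt (<) ?b" "\<forall>x\<in>set ?b. x < nodes l"
    and br: "\<forall>x\<in>set (butlast (cuts r)). x < nodes r"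
    by (auto simp: sorted_wrt_append)
  have "\<forall>x\<in>set (cuts r). x \<le> nodes r"
    by (subst r) (use br in auto)
  then have "\<forall>x\<in>set (drop i (cuts r)). x \<le> nodes r"
    using set_drop_subset[of i "cuts r"] by auto
  moreover have "sorted_wrt (<) (drop i (cuts r))"
    using Node by (simp add: sorted_wrt_drop)
  moreover have "hd (cuts (Node l r i)) = 0"
  proof (cases "l = Leaf")
    case True
    then show ?thesis using Node by (auto simp: hd_append hd_map)
  next
    case False
    then have "?b \<noteq> []" using Node l by (metis append_Nil hd_append2 list.sel(1) nodes_eq_0 valid.simps(2))
    then show ?thesis using Node l by (metis cuts.simps(2) hd_append2 valid.simps(2))
  qed
  ultimately show ?case
    using bl by (auto simp: sorted_wrt_append sorted_wrt_map less_Suc_eq_le)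
qed auto

lemma cuts_le: "valid t \<Longrightarrow> v \<in> set (cuts t) \<Longrightarrow> v \<le> nodes t"
proof -
  assume "valid t" "v \<in> set (cuts t)"
  then have "sorted_wrt (<) (butlast (cuts t) @ [nodes t])" "v \<in> set (butlast (cuts t) @ [nodes t])"
    using cuts_sorted[of t] append_butlast_last_id[of "cuts t"] by auto
  then show ?thesis by (auto simp: sorted_wrt_append)
qed

lemma valid_NodeD:
  assumes "valid (Node l r i)"
  shows "cuts r ! i \<le> nodes r" "nodes l = 0 \<longrightarrow> cuts r ! i = 0"
  using assms cuts_le[of r] cuts_sorted[of r] by (auto simp: hd_conv_nth)

lemma set_perm_of:
  assumes "valid t"
  shows "set (perm_of t) = {..<nodes t}"
  using assms
proof (induction t)
  case (Node l r i)
  have "set (perm_of (Node l r i)) = insert (nodes l + nodes r) {..<nodes l + nodes r}"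
    using label_images[OF valid_NodeD[OF Node.prems]] Node by auto
  then show ?case by auto
qed auto

lemma distinct_perm_of: "valid t \<Longrightarrow> distinct (perm_of t)"
  by (rule card_distinct) (simp add: set_perm_of)

lemma stack_sort_perm_of_Node:
  assumes "valid (Node l r i)"
  shows "stack_sort (perm_of (Node l r i)) =
    map (left_label (nodes l) (cuts r ! i)) (stack_sort (perm_of l)) @
    map (right_label (nodes l) (cuts r ! i)) (stack_sort (perm_of r)) @ [nodes l + nodes r]"
proof -
  have "\<forall>a\<in>set (map (left_label (nodes l) (cuts r ! i)) (perm_of l)) \<union>
      set (map (right_label (nodes l) (cuts r ! i)) (perm_of r)). a < nodes l + nodes r"
    using label_images[OF valid_NodeD[OF assms]] assms by (auto simp: set_perm_of)
  moreover have "strict_mono_on (set (perm_of l)) (left_label (nodes l) (cuts r ! i))"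
    using assms left_label_mono by (simp add: set_perm_of)
  moreover have "strict_mono_on (set (perm_of r)) (right_label (nodes l) (cuts r ! i))"
    using valid_NodeD[OF assms] by (intro right_label_mono) simp
  ultimately show ?thesis
    by (simp add: stack_sort_max stack_sort_map)
qed

text \<open>This justifies the reading of \<open>cuts\<close>. A cut of the left part below
  \<open>nodes l\<close> does not see the moved maximum; at a cut of the right part from
  \<open>cuts r ! i\<close> on, that maximum already belongs to the initial segment.\<close>

lemma set_take_cut:
  assumes "valid t" "u \<in> set (cuts t)"
  shows "set (take u (stack_sort (perm_of t))) = {..<u}"
  using assms
proof (induction t arbitrary: u)
  case (Node l r i)
  let ?k = "nodes l" and ?v = "cuts r ! i"
  note v = valid_NodeD[OF Node.prems(1)]
  have l: "cuts l = butlast (cuts l) @ [?k]" "sorted_wrt (<) (cuts l)"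
    using Node.prems cuts_sorted[of l] by (metis append_butlast_last_id cuts_not_Nil valid.simps(2))+
  then have "sorted_wrt (<) (butlast (cuts l) @ [?k])" by simp
  then have bl: "\<forall>x\<in>set (butlast (cuts l)). x < ?k" by (simp add: sorted_wrt_append)
  consider "u \<in> set (butlast (cuts l))" | u' where "u' \<in> set (drop i (cuts r))" "u = ?k + u'"
    | "u = Suc (?k + nodes r)"
    using Node.prems(2) by auto
  then show ?case
  proof cases
    case 1
    then have "u < ?k" "u \<in> set (cuts l)" using bl by (auto dest: in_set_butlastD)
    then have "take u (stack_sort (perm_of (Node l r i))) =
        map (left_label ?k ?v) (take u (stack_sort (perm_of l)))"
      by (simp add: stack_sort_perm_of_Node[OF Node.prems(1)] take_map del: perm_of.simps)
    then show ?thesis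
      using Node \<open>u < ?k\<close> \<open>u \<in> set (cuts l)\<close>
      by (auto simp: left_label_def image_iff Bex_def simp del: perm_of.simps)
  next
    case 2
    then have "u' \<in> set (cuts r)" using in_set_dropD by metis
    have "sorted_wrt (<) (drop i (cuts r))" "drop i (cuts r) = ?v # drop (Suc i) (cuts r)"
      using cuts_sorted[of r] Node.prems by (auto simp: sorted_wrt_drop Cons_nth_drop_Suc)
    then have "?v \<le> u'" using 2(1) by auto
    have "u' \<le> nodes r" using cuts_le \<open>u' \<in> set (cuts r)\<close> Node.prems by auto
    then have "take u (stack_sort (perm_of (Node l r i))) = map (left_label ?k ?v) (stack_sort (perm_of l)) @
        map (right_label ?k ?v) (take u' (stack_sort (perm_of r)))"
      by (simp add: 2 stack_sort_perm_of_Node[OF Node.prems(1)] take_map del: perm_of.simps)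
    then show ?thesis
      using label_images[OF \<open>?v \<le> u'\<close> v(2)] Node \<open>u' \<in> set (cuts r)\<close> 2
      by (simp add: set_perm_of del: perm_of.simps)
  next
    case 3
    then show ?thesis using set_perm_of[OF Node.prems(1)] by (simp del: perm_of.simps)
  qed
qed auto

text \<open>The image under s is \<open>?L @ ?R\<close> followed by the maximum. As
  \<open>?v\<close> is a cut, \<open>?R\<close> consists of a block of its \<open>?v\<close>
  smallest values and a block of the others, and \<open>?L\<close> ends with its maximum. Then
  \<open>?L\<close> without that maximum, the maximum with the first block, and the second block
  occupy increasing ranges of values and are sorted separately.\<close>

lemma stack_sort_stack_sort_perm_of:
  assumes "valid t"
  shows "stack_sort (stack_sort (perm_of t)) = [0..<nodes t]"
  using assms
proof (induction t)
  case (Node l r i)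
  let ?k = "nodes l" and ?v = "cuts r ! i" and ?n = "nodes r"
  let ?L = "map (left_label ?k ?v) (stack_sort (perm_of l))"
  let ?R = "map (right_label ?k ?v) (stack_sort (perm_of r))"
  note v = valid_NodeD[OF Node.prems]
  define P where "P = take ?v (stack_sort (perm_of r))"
  define Q where "Q = drop ?v (stack_sort (perm_of r))"
  have PQ: "stack_sort (perm_of r) = P @ Q" by (simp add: P_def Q_def)
  have P: "set P = {..<?v}" unfolding P_def
    using Node.prems by (intro set_take_cut) auto
  have "distinct (stack_sort (perm_of r))" "set (stack_sort (perm_of r)) = {..<?n}"
    using Node.prems by (auto simp: distinct_perm_of set_perm_of)
  then have "set P \<inter> set Q = {}" "set P \<union> set Q = {..<?n}" unfolding PQ by simp_all
  then have "set Q = {..<?n} - {..<?v}" unfolding P by blast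
  then have Q: "set Q = {?v..<?n}" by auto
  \<comment> \<open>Because \<open>P\<close> lies below \<open>Q\<close>, the induction hypothesis
    for \<open>r\<close> splits into one statement for each block.\<close>
  have "stack_sort (P @ Q) = stack_sort P @ stack_sort Q"
    by (rule stack_sort_append) (auto simp: P Q)
  moreover have "stack_sort (P @ Q) = [0..<?n]"
    unfolding PQ[symmetric] using Node.IH(2) Node.prems by simp
  moreover have "[0..<?v] @ [?v..<?n] = [0..<?n]"
    using v(1) upt_add_eq_append[of 0 ?v "?n - ?v"] by simp
  ultimately have "stack_sort P @ stack_sort Q = [0..<?v] @ [?v..<?n]"
    by (simp only:)
  moreover have "length (stack_sort P) = length [0..<?v]"
    using v(1) by (simp add: P_def)
  ultimately have sP: "stack_sort P = [0..<?v]" and sQ: "stack_sort Q = [?v..<?n]"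
    by simp_all
  have "stack_sort (?L @ ?R) = [0..<?k + ?n]"
  proof (cases "l = Leaf")
    case True
    then have "?R = stack_sort (perm_of r)"
      using v by (intro map_idI) (auto simp: right_label_def)
    then show ?thesis using True Node by simp
  next
    case False
    then have kpos: "0 < ?k" by (metis nodes_eq_0 neq0_conv)
    from False obtain l1 l2 j where lN: "l = Node l1 l2 j" by (cases l) auto
    define A where "A = butlast (stack_sort (perm_of l))"
    have A: "stack_sort (perm_of l) = A @ [?k - 1]"
      using stack_sort_perm_of_Node[of l1 l2 j] Node.prems by (simp add: A_def lN butlast_append)
    have "distinct (A @ [?k - 1])" "set (A @ [?k - 1]) = {..<?k}"
      unfolding A[symmetric] using Node.prems by (auto simp: distinct_perm_of set_perm_of)
    then have "?k - 1 \<notin> set A" "insert (?k - 1) (set A) = {..<?k}" by simp_all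
    then have "set A = {..<?k} - {?k - 1}" by blast
    moreover have "{..<n} - {n - 1} = {..<n - 1}" for n :: nat by auto
    ultimately have setA: "set A = {..<?k - 1}" by (simp only:)
    have "stack_sort (A @ [?k - 1]) = stack_sort A @ [?k - 1]"
      by (rule stack_sort_snoc) (simp add: setA)
    moreover have "stack_sort (A @ [?k - 1]) = [0..<?k]"
      unfolding A[symmetric] using Node.IH(1) Node.prems by simp
    moreover have "[0..<?k] = [0..<?k - 1] @ [?k - 1]"
      using kpos by (cases ?k) auto
    ultimately have "stack_sort A @ [?k - 1] = [0..<?k - 1] @ [?k - 1]"
      by (simp only:)
    then have sA: "stack_sort A = [0..<?k - 1]" by simp
    have L: "?L = A @ [?k - 1 + ?v]"
      using kpos by (auto simp: A left_label_def setA intro!: map_idI)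
    have R: "?R = map ((+) (?k - 1)) P @ map ((+) ?k) Q"
      by (auto simp: PQ right_label_def P Q)
    have "stack_sort (?L @ ?R) = stack_sort (A @ ((?k - 1 + ?v) # map ((+) (?k - 1)) P) @ map ((+) ?k) Q)"
      by (simp add: L R)
    also have "\<dots> = stack_sort A @ stack_sort ((?k - 1 + ?v) # map ((+) (?k - 1)) P) @
        stack_sort (map ((+) ?k) Q)"
    proof -
      have "stack_sort (A @ ((?k - 1 + ?v) # map ((+) (?k - 1)) P) @ map ((+) ?k) Q) =
          stack_sort A @ stack_sort (((?k - 1 + ?v) # map ((+) (?k - 1)) P) @ map ((+) ?k) Q)"
        by (rule stack_sort_append) (auto simp: setA P Q)
      also have "stack_sort (((?k - 1 + ?v) # map ((+) (?k - 1)) P) @ map ((+) ?k) Q) =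
          stack_sort ((?k - 1 + ?v) # map ((+) (?k - 1)) P) @ stack_sort (map ((+) ?k) Q)"
        using kpos by (intro stack_sort_append) (auto simp: P Q)
      finally show ?thesis .
    qed
    also have "stack_sort ((?k - 1 + ?v) # map ((+) (?k - 1)) P) =
        stack_sort (map ((+) (?k - 1)) P) @ [?k - 1 + ?v]"
      using stack_sort_max[of "[]" "map ((+) (?k - 1)) P" "?k - 1 + ?v"] by (auto simp: P)
    also have "stack_sort (map ((+) (?k - 1)) P) = map ((+) (?k - 1)) [0..<?v]"
      by (subst stack_sort_map) (auto simp: sP strict_mono_on_def)
    also have "stack_sort (map ((+) ?k) Q) = map ((+) ?k) [?v..<?n]"
      by (subst stack_sort_map) (auto simp: sQ strict_mono_on_def)
    also have "stack_sort A @ (map ((+) (?k - 1)) [0..<?v] @ [?k - 1 + ?v]) @ map ((+) ?k) [?v..<?n] =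
        [0..<?k + ?n]"
      using kpos v(1) unfolding sA
      by (intro nth_equalityI) (auto simp: nth_append nth_Cons')
    finally show ?thesis .
  qed
  moreover have "stack_sort ((?L @ ?R) @ [?k + ?n]) = stack_sort (?L @ ?R) @ [?k + ?n]"
    using label_images[OF v] Node.prems by (intro stack_sort_snoc) (auto simp: set_perm_of)
  ultimately show ?case
    by (simp add: stack_sort_perm_of_Node[OF Node.prems] del: perm_of.simps)
qed auto

text \<open>The position of the maximum separates the two parts, the set of values of the left part
  gives the insertion value, and this determines the label because the cuts are distinct.\<close>

lemma perm_of_inject:
  assumes "valid t" "valid t'" "perm_of t = perm_of t'"
  shows "t = t'"
  using assms
proof (induction t arbitrary: t')
  case Leaf
  then show ?case by (metis length_0_conv length_perm_of nodes_eq_0 perm_of.simps(1))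
next
  case (Node l r i)
  have "nodes t' = nodes (Node l r i)" using Node.prems(3) length_perm_of by metis
  then obtain l' r' i' where t': "t' = Node l' r' i'" by (cases t') auto
  let ?k = "nodes l" and ?v = "cuts r ! i" and ?v' = "cuts r' ! i'"
  have sum: "nodes l' + nodes r' = ?k + nodes r"
    using \<open>nodes t' = nodes (Node l r i)\<close> t' by simp
  note v = valid_NodeD[OF Node.prems(1)] and v' = valid_NodeD[OF Node.prems(2)[unfolded t']]
  have "?k + nodes r \<notin> set (map (left_label ?k ?v) (perm_of l))"
    "?k + nodes r \<notin> set (map (right_label ?k ?v) (perm_of r))"
    using label_images[OF v] Node.prems(1) by (auto simp: set_perm_of)
  from append_Cons_eq_iff[OF this]
  have eq: "map (left_label ?k ?v) (perm_of l) = map (left_label (nodes l') ?v') (perm_of l')"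
      "map (right_label ?k ?v) (perm_of r) = map (right_label (nodes l') ?v') (perm_of r')"
    using Node.prems(3) by (auto simp: t' sum)
  have k: "nodes l' = ?k" using map_eq_imp_length_eq[OF eq(1)] by simp
  have vv: "?v' = ?v"
  proof (cases "?k = 0")
    case True
    then show ?thesis using v v' k by simp
  next
    case False
    have "left_label ?k ?v ` {..<?k} = left_label ?k ?v' ` {..<?k}"
      using arg_cong[OF eq(1), of set] Node.prems by (simp add: set_perm_of k t')
    then have "insert (?k - 1 + ?v) {..<?k - 1} = insert (?k - 1 + ?v') {..<?k - 1}"
      using left_label_image[of ?k] False by (metis neq0_conv)
    then have "?k - 1 + ?v' \<in> insert (?k - 1 + ?v) {..<?k - 1}" by blast
    then show ?thesis by simp
  qed
  have "inj_on (left_label ?k ?v) {..<?k}" by (intro strict_mono_on_imp_inj_on left_label_mono)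
  then have "perm_of l = perm_of l'"
    using eq(1) Node.prems by (simp add: k vv t' map_inj_on set_perm_of)
  then have "l = l'" using Node by (simp add: t')
  have "inj_on (right_label ?k ?v) UNIV"
    using v(2) by (intro strict_mono_on_imp_inj_on right_label_mono) simp
  then have "perm_of r = perm_of r'"
    using eq(2) by (simp add: k vv map_inj_on inj_on_def)
  then have "r = r'" using Node by (simp add: t')
  moreover have "distinct (cuts r)"
    using cuts_sorted[of r] Node.prems(1) by (simp add: strict_sorted_iff)
  ultimately have "i = i'"
    using vv Node.prems by (auto simp: t' nth_eq_iff_index_eq)
  then show ?case using \<open>l = l'\<close> \<open>r = r'\<close> t' by simp
qed

section \<open>Preimage counts computed on trees\<close>

fun tail_fertility :: "dtree \<Rightarrow> nat \<Rightarrow> nat" where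
  "tail_fertility Leaf n = catalan n"
| "tail_fertility (Node l r i) n =
     (if r = Leaf then tail_fertility l (Suc n)
      else \<Sum>j<n. tail_fertility l (n - j) * tail_fertility r j)"

text \<open>The increasing map \<open>h\<close> is needed for the induction, where both subtrees
  occur with relabelled values. For \<open>l\<close> the root entry joins the tail, which makes the
  tail longer by one.\<close>

lemma fertility_perm_of:
  assumes "valid t" "strict_mono_on {..<nodes t} h" "sorted_wrt (<) ts"
    and "\<And>y x. y < nodes t \<Longrightarrow> x \<in> set ts \<Longrightarrow> h y < x"
  shows "fertility (map h (perm_of t) @ ts) = tail_fertility t (length ts)"
  using assms
proof (induction t arbitrary: h ts)
  case Leaf
  then show ?case by (simp add: fertility_sorted)
next
  case (Node l r i)
  let ?k = "nodes l" and ?v = "cuts r ! i" and ?n = "nodes r"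
  let ?hl = "h \<circ> left_label ?k ?v" and ?hr = "h \<circ> right_label ?k ?v"
  note v = valid_NodeD[OF Node.prems(1)]
  have h: "x < y \<Longrightarrow> y \<le> ?k + ?n \<Longrightarrow> h x < h y" for x y
    using Node.prems(2) by (auto simp: strict_mono_on_def)
  have ll: "left_label ?k ?v y < ?k + ?n" if "y < ?k" for y
    using label_images[OF v] that by auto
  have rl: "right_label ?k ?v y < ?k + ?n" if "y < ?n" for y
    using label_images[OF v] that by auto
  have ml: "strict_mono_on {..<?k} ?hl"
    using left_label_mono[of ?k ?v] ll by (auto simp: strict_mono_on_def intro!: h less_imp_le)
  have mr: "strict_mono_on {..<?n} ?hr"
    using right_label_mono[OF v(2), of "{..<?n}"] rl by (auto simp: strict_mono_on_def intro!: h less_imp_le)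
  have IHl: "fertility (map ?hl (perm_of l) @ h (?k + ?n) # us) = tail_fertility l (Suc (length us))"
    if "sorted_wrt (<) us" "set us \<subseteq> set ts" for us
  proof -
    have "fertility (map ?hl (perm_of l) @ h (?k + ?n) # us) = tail_fertility l (length (h (?k + ?n) # us))"
    proof (rule Node.IH(1)[OF _ ml])
      show "?hl y < x" if "y < ?k" "x \<in> set (h (?k + ?n) # us)" for y x
        using that \<open>set us \<subseteq> set ts\<close> ll[of y] by (auto intro: h Node.prems(4) less_SucI)
    qed (use that Node.prems in auto)
    then show ?thesis by simp
  qed
  have IHr: "fertility (map ?hr (perm_of r) @ us) = tail_fertility r (length us)"
    if "sorted_wrt (<) us" "set us \<subseteq> set ts" for us
  proof (rule Node.IH(2)[OF _ mr])
    show "?hr y < x" if "y < ?n" "x \<in> set us" for y x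
      using that \<open>set us \<subseteq> set ts\<close> rl[of y] by (auto intro!: Node.prems(4) intro: less_SucI)
  qed (use that Node.prems in auto)
  have split: "map h (perm_of (Node l r i)) @ ts =
      map ?hl (perm_of l) @ h (?k + ?n) # map ?hr (perm_of r) @ ts"
    by simp
  show ?case
  proof (cases "r = Leaf")
    case True
    then show ?thesis using IHl[of ts] Node.prems(3) unfolding split by simp
  next
    case False
    have "fertility (map ?hl (perm_of l) @ h (?k + ?n) # map ?hr (perm_of r) @ ts) =
      (\<Sum>j<length ts. fertility (map ?hl (perm_of l) @ h (?k + ?n) # drop (Suc j) ts) *
         fertility (map ?hr (perm_of r) @ take j ts))"
    proof (rule fertility_append_tail)
      show "sorted_wrt (<) ts" by fact
      have "inj_on h {..<nodes (Node l r i)}"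
        using Node.prems(2) by (rule strict_mono_on_imp_inj_on)
      then have "distinct (map h (perm_of (Node l r i)))"
        using Node.prems(1) by (simp only: distinct_map set_perm_of distinct_perm_of simp_thms)
      moreover have "distinct ts" using Node.prems(3) by (simp add: strict_sorted_iff)
      moreover have "set (map h (perm_of (Node l r i))) \<inter> set ts = {}"
        using Node.prems(1,4) set_perm_of[OF Node.prems(1)]
        by (auto simp del: perm_of.simps nodes.simps)
      ultimately have "distinct (map h (perm_of (Node l r i)) @ ts)"
        by (simp only: distinct_append)
      then show "distinct (map ?hl (perm_of l) @ h (?k + ?n) # map ?hr (perm_of r) @ ts)"
        unfolding split .
      show "map ?hr (perm_of r) \<noteq> []" using False by (metis length_0_conv length_map length_perm_of nodes_eq_0)
      show "x < h (?k + ?n)" if "x \<in> set (map ?hr (perm_of r))" for x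
        using that rl Node.prems(1) by (auto simp: set_perm_of intro!: h)
      show "x < y" if "x \<in> set (map ?hl (perm_of l) @ h (?k + ?n) # map ?hr (perm_of r))" "y \<in> set ts" for x y
        using that ll rl Node.prems(1,4) by (auto simp: set_perm_of less_Suc_eq)
    qed
    also have "\<dots> = (\<Sum>j<length ts. tail_fertility l (length ts - j) * tail_fertility r j)"
      using Node.prems(3) set_drop_subset set_take_subset
      by (intro sum.cong refl arg_cong2[where f = "(*)"])
        (subst IHl IHr, auto simp: sorted_wrt_drop sorted_wrt_take Suc_diff_Suc dest: in_set_dropD in_set_takeD)+
    finally show ?thesis using False unfolding split by simp
  qed
qed

section \<open>Existence of the limit\<close>

text \<open>The partial sums S(N) of \<open>catalan n / 4 ^ n\<close> satisfy S(N + 1) \<le> 1 +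
  S(N) * S(N) / 4, so the bound 2 is preserved.\<close>

lemma catalan_le: "catalan n \<le> 2 * 4 ^ n"
proof -
  have S: "(\<Sum>n<N. real (catalan n) / 4 ^ n) \<le> 2" for N
  proof (induction N)
    case (Suc N)
    let ?f = "\<lambda>n. real (catalan n) / 4 ^ n"
    have "(\<Sum>n<N. ?f (Suc n)) = (\<Sum>n<N. (\<Sum>k\<le>n. ?f k * ?f (n - k)) / 4)"
    proof (rule sum.cong[OF refl])
      fix n
      have "?f (Suc n) = (\<Sum>k\<le>n. real (catalan k * catalan (n - k)) / 4 ^ n) / 4"
        by (simp add: sum_divide_distrib mult.commute)
      also have "(\<Sum>k\<le>n. real (catalan k * catalan (n - k)) / 4 ^ n) = (\<Sum>k\<le>n. ?f k * ?f (n - k))"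
        by (intro sum.cong) (auto simp flip: power_add)
      finally show "?f (Suc n) = (\<Sum>k\<le>n. ?f k * ?f (n - k)) / 4" .
    qed
    also have "\<dots> = (\<Sum>n<N. \<Sum>k\<le>n. ?f k * ?f (n - k)) / 4"
      by (rule sum_divide_distrib[symmetric])
    also have "(\<Sum>n<N. \<Sum>k\<le>n. ?f k * ?f (n - k)) =
        (\<Sum>(n, k)\<in>(SIGMA n:{..<N}. {..n}). ?f k * ?f (n - k))"
      by (simp add: sum.Sigma)
    also have "\<dots> = (\<Sum>(k, j)\<in>{(k, j). k + j < N}. ?f k * ?f j)"
      by (rule sum.reindex_bij_witness[of _ "\<lambda>(k, j). (k + j, k)" "\<lambda>(n, k). (k, n - k)"]) auto
    also have "\<dots> \<le> (\<Sum>(k, j)\<in>{..<N} \<times> {..<N}. ?f k * ?f j)"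
      by (rule sum_mono2) auto
    also have "\<dots> = (\<Sum>k<N. ?f k) * (\<Sum>k<N. ?f k)"
      by (simp add: sum_product sum.cartesian_product)
    also have "\<dots> \<le> 2 * 2"
      using Suc.IH by (intro mult_mono sum_nonneg) auto
    finally have "(\<Sum>n<N. ?f (Suc n)) \<le> 1" by simp
    then show ?case by (subst sum.lessThan_Suc_shift) simp
  qed simp
  have "real (catalan n) / 4 ^ n \<le> (\<Sum>n<Suc n. real (catalan n) / 4 ^ n)"
    by (rule member_le_sum) auto
  also note S[of "Suc n"]
  finally have "real (catalan n) \<le> real (2 * 4 ^ n)" by (simp add: field_simps)
  then show ?thesis by (simp only: of_nat_le_iff)
qed

text \<open>\<open>fertility_snoc\<close> is dominated termwise by the Catalan recursion; a list
  that does not end with its maximum has no preimage.\<close>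

lemma fertility_le_catalan:
  assumes "distinct q"
  shows "fertility q \<le> catalan (length q)"
  using assms
proof (induction "length q" arbitrary: q rule: less_induct)
  case less
  show ?case
  proof (cases q rule: rev_exhaust)
    case (snoc r b)
    show ?thesis
    proof (cases "\<forall>a\<in>set r. a < b")
      case True
      then have "fertility q = (\<Sum>k\<le>length r. fertility (take k r) * fertility (drop k r))"
        by (simp add: snoc fertility_snoc)
      also have "\<dots> \<le> (\<Sum>k\<le>length r. catalan k * catalan (length r - k))"
      proof (intro sum_mono mult_mono)
        fix k assume "k \<in> {..length r}"
        then show "fertility (take k r) \<le> catalan k" "fertility (drop k r) \<le> catalan (length r - k)"
          using less.hyps[of "take k r"] less.hyps[of "drop k r"] less.prems snoc by auto
      qed auto
      finally show ?thesis by (simp add: snoc)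
    next
      case False
      then obtain a where "a \<in> set r" "b \<le> a" by (auto simp: not_less)
      then have "b < a" using less.prems snoc by (cases "a = b") auto
      then show ?thesis
        using fertility_eq_0[of r b a] less.prems snoc \<open>a \<in> set r\<close> by simp
    qed
  qed simp
qed

lemma card_stack_sort_vimage_le:
  assumes "finite A" "\<And>q. q \<in> A \<Longrightarrow> distinct q \<and> length q = n"
  shows "finite {p. stack_sort p \<in> A}" "card {p. stack_sort p \<in> A} \<le> card A * (2 * 4 ^ n)"
proof -
  have eq: "{p. stack_sort p \<in> A} = (\<Union>q\<in>A. {p. stack_sort p = q})" by auto
  show "finite {p. stack_sort p \<in> A}" unfolding eq using assms(1) by (intro finite_UN_I) simp_all
  have "card (\<Union>q\<in>A. {p. stack_sort p = q}) \<le> (\<Sum>q\<in>A. fertility q)"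
    unfolding fertility_def by (rule card_UN_le) fact
  also have "\<dots> \<le> (\<Sum>q\<in>A. 2 * 4 ^ n)"
  proof (rule sum_mono)
    fix q assume "q \<in> A"
    then have "fertility q \<le> catalan n" using assms(2) fertility_le_catalan by metis
    then show "fertility q \<le> 2 * 4 ^ n" using catalan_le[of n] by linarith
  qed
  finally show "card {p. stack_sort p \<in> A} \<le> card A * (2 * 4 ^ n)" by (simp add: eq)
qed

text \<open>Starting from the increasing permutation, preimages are taken three times, and each time
  the number grows by a factor of at most \<open>2 * 4 ^ n\<close>.\<close>

lemma W3_le: "W3 n \<le> 8 * 64 ^ n"
proof -
  define A where "A = {[1..<Suc n]}"
  define B where "B = {p. stack_sort p \<in> A}"
  define C where "C = {p. stack_sort p \<in> B}"
  have A: "finite A" "\<And>q. q \<in> A \<Longrightarrow> distinct q \<and> length q = n"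
    by (auto simp: A_def)
  have B: "finite B" "card B \<le> card A * (2 * 4 ^ n)" "q \<in> B \<Longrightarrow> distinct q \<and> length q = n" for q
    using card_stack_sort_vimage_le[OF A] A(2)[of "stack_sort q"] unfolding B_def by auto
  have C: "finite C" "card C \<le> card B * (2 * 4 ^ n)" "q \<in> C \<Longrightarrow> distinct q \<and> length q = n" for q
    using card_stack_sort_vimage_le[OF B(1) B(3)] B(3)[of "stack_sort q"] unfolding C_def by auto
  have D: "finite {p. stack_sort p \<in> C}" "card {p. stack_sort p \<in> C} \<le> card C * (2 * 4 ^ n)"
    using card_stack_sort_vimage_le[OF C(1) C(3)] by auto
  have "{p \<in> permutations_of_set {1..n}. three_stack_sortable p} \<subseteq> {p. stack_sort p \<in> C}"
  proof safe
    fix p assume p: "p \<in> permutations_of_set {1..n}" "three_stack_sortable p"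
    let ?q = "stack_sort (stack_sort (stack_sort p))"
    have "set ?q = {1..n}" "sorted_wrt (<) ?q"
      using p by (simp_all add: permutations_of_set_def three_stack_sortable_def)
    moreover have "set [1..<Suc n] = {1..n}" by (simp only: set_upt atLeastLessThanSuc_atLeastAtMost)
    ultimately have "set [1..<Suc n] = set ?q" "sorted_wrt (<) ?q" by simp_all
    then have "?q = [1..<Suc n]"
      by (intro strict_sorted_equal) (simp_all del: upt_Suc)
    then show "stack_sort p \<in> C" unfolding A_def B_def C_def by blast
  qed
  then have "W3 n \<le> card {p. stack_sort p \<in> C}"
    unfolding W3_def using D(1) by (intro card_mono)
  also have "\<dots> \<le> card A * (2 * 4 ^ n) * (2 * 4 ^ n) * (2 * 4 ^ n)"
    using D(2) C(2) B(2) by (meson le_trans mult_le_mono1)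
  also have "\<dots> = 8 * (4 ^ n * 4 ^ n * 4 ^ n)" by (simp add: A_def)
  also have "\<dots> = 8 * 64 ^ n" by (simp flip: power_mult_distrib)
  finally show ?thesis .
qed

text \<open>The direct sum of two 3-stack-sortable permutations is 3-stack-sortable, and it
  determines its summands once their lengths are fixed.\<close>

lemma W3_mult_le: "W3 m * W3 n \<le> W3 (m + n)"
proof -
  let ?T = "\<lambda>n. {p \<in> permutations_of_set {1..n}. three_stack_sortable p}"
  let ?f = "\<lambda>(p, q). p @ map ((+) m) q"
  have "?f ` (?T m \<times> ?T n) \<subseteq> ?T (m + n)"
  proof
    fix x assume "x \<in> ?f ` (?T m \<times> ?T n)"
    then obtain y where y: "y \<in> ?T m \<times> ?T n" "x = ?f y" by (elim imageE)
    obtain p q where "y = (p, q)" by (cases y)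
    with y have x: "x = p @ map ((+) m) q" and pq: "p \<in> permutations_of_set {1..m}"
      "three_stack_sortable p" "q \<in> permutations_of_set {1..n}" "three_stack_sortable q"
      by simp_all
    from pq have sets: "set p = {1..m}" "set q = {1..n}" "distinct p" "distinct q"
      by (auto simp: permutations_of_set_def)
    have "{1..m} \<union> (+) m ` {1..n} = {1..m + n}" by auto
    then have perm: "p @ map ((+) m) q \<in> permutations_of_set {1..m + n}"
      using sets by (auto simp: permutations_of_set_def distinct_map)
    have app: "stack_sort (p' @ map ((+) m) q') = stack_sort p' @ map ((+) m) (stack_sort q')"
      if "set p' = {1..m}" "set q' = {1..n}" for p' q'
      using that by (subst stack_sort_append) (auto simp: stack_sort_map strict_mono_on_def)
    let ?p = "stack_sort (stack_sort (stack_sort p))" and ?q = "stack_sort (stack_sort (stack_sort q))"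
    have "stack_sort (stack_sort (stack_sort (p @ map ((+) m) q))) = ?p @ map ((+) m) ?q"
      using sets by (simp add: app)
    moreover have "sorted_wrt (<) (?p @ map ((+) m) ?q)"
      using pq sets by (auto simp: three_stack_sortable_def sorted_wrt_append sorted_wrt_map)
    ultimately have "three_stack_sortable (p @ map ((+) m) q)"
      by (simp add: three_stack_sortable_def)
    with perm show "x \<in> ?T (m + n)" by (simp add: x)
  qed
  moreover have "inj_on ?f (?T m \<times> ?T n)"
  proof (rule inj_onI, clarify)
    fix p q p' q' assume pq: "p \<in> permutations_of_set {1..m}" "p' \<in> permutations_of_set {1..m}"
      and eq: "p @ map ((+) m) q = p' @ map ((+) m) q'"
    then have "length p = length p'"
      by (metis length_finite_permutations_of_set)
    then show "p = p' \<and> q = q'"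
      using eq by (simp add: inj_map_eq_map)
  qed
  ultimately have "card (?T m \<times> ?T n) \<le> card (?T (m + n))"
    by (intro card_inj_on_le) auto
  then show ?thesis by (simp add: W3_def card_cartesian_product)
qed

text \<open>Distinct trees give distinct permutations and hence disjoint sets of preimages.
  \<open>Suc\<close> passes from the values \<open>{..<n}\<close> to \<open>{1..n}\<close>.\<close>

lemma sum_tail_fertility_le_W3:
  assumes "finite T" "\<And>t. t \<in> T \<Longrightarrow> valid t \<and> nodes t = n"
  shows "(\<Sum>t\<in>T. tail_fertility t 0) \<le> W3 n"
proof -
  let ?S = "\<lambda>t. {p. stack_sort p = map Suc (perm_of t)}"
  have mono: "strict_mono_on A Suc" for A by (auto simp: strict_mono_on_def)
  have "(\<Sum>t\<in>T. tail_fertility t 0) = (\<Sum>t\<in>T. card (?S t))"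
    using fertility_perm_of[OF _ mono, of _ "[]"] assms(2)
    by (intro sum.cong) (auto simp: fertility_def)
  also have "\<dots> = card (\<Union>t\<in>T. ?S t)"
    using assms perm_of_inject by (intro card_UN_disjoint[symmetric]) (auto simp: map_inj_on)
  also have "\<dots> \<le> W3 n"
    unfolding W3_def
  proof (rule card_mono)
    show "(\<Union>t\<in>T. ?S t) \<subseteq> {p \<in> permutations_of_set {1..n}. three_stack_sortable p}"
    proof safe
      fix t p assume t: "t \<in> T" "stack_sort p = map Suc (perm_of t)"
      have "set p = {1..n}" "distinct p"
        using set_stack_sort[of p] distinct_stack_sort[of p] assms(2)[OF t(1)] unfolding t(2)
        by (simp_all add: set_perm_of distinct_perm_of distinct_map image_Suc_lessThan)
      then show "p \<in> permutations_of_set {1..n}" by (simp add: permutations_of_set_def)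
      show "three_stack_sortable p"
        using assms(2)[OF t(1)]
        by (simp add: three_stack_sortable_def t(2) stack_sort_map mono stack_sort_stack_sort_perm_of
              sorted_wrt_map)
    qed
  qed auto
  finally show ?thesis .
qed

lemma W3_ge_1: "W3 n \<ge> 1"
proof -
  \<comment> \<open>The left comb encodes the increasing permutation.\<close>
  define t where "t = ((\<lambda>t. Node t Leaf 0) ^^ n) Leaf"
  have t: "valid t \<and> nodes t = n \<and> tail_fertility t k \<ge> 1" for k
  proof -
    have "catalan k \<ge> 1" for k
    proof (induction k)
      case (Suc k)
      then have "1 \<le> catalan 0 * catalan (k - 0)" by simp
      also have "\<dots> \<le> catalan (Suc k)"
        unfolding catalan.simps(2) by (rule member_le_sum) auto
      finally show ?case .
    qed simp
    then show ?thesis unfolding t_def by (induction n arbitrary: k) auto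
  qed
  have "tail_fertility t 0 \<le> W3 n"
    using sum_tail_fertility_le_W3[of "{t}" n] t[of 0] by simp
  then show ?thesis using t[of 0] by linarith
qed

text \<open>Fekete's argument: the limit is the supremum. If the root at a fixed \<open>m\<close> is
  close to it, division of \<open>n\<close> by \<open>m\<close> with remainder costs at most a
  factor \<open>r ^ m\<close>, whose n-th root tends to 1.\<close>

lemma supermultiplicative_root_convergent:
  fixes a :: "nat \<Rightarrow> real"
  assumes ge1: "\<And>n. a n \<ge> 1" and mult: "\<And>m n. a m * a n \<le> a (m + n)"
    and bound: "\<And>n. n > 0 \<Longrightarrow> a n \<le> c ^ n" and "c \<ge> 0"
  shows "convergent (\<lambda>n. root n (a n))"
proof -
  define L where "L = (SUP n. root (Suc n) (a (Suc n)))"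
  have bdd: "bdd_above (range (\<lambda>n. root (Suc n) (a (Suc n))))"
  proof (rule bdd_aboveI2)
    fix n
    have "root (Suc n) (a (Suc n)) \<le> root (Suc n) (c ^ Suc n)"
      by (rule real_root_le_mono) (use bound[of "Suc n"] in auto)
    also have "\<dots> = c" using \<open>c \<ge> 0\<close> by (rule real_root_power_cancel[OF zero_less_Suc])
    finally show "root (Suc n) (a (Suc n)) \<le> c" .
  qed
  have upper: "root n (a n) \<le> L" if "n > 0" for n
    using cSUP_upper[OF UNIV_I bdd, of "n - 1"] that by (simp add: L_def)
  have power: "a m ^ k \<le> a (k * m)" for m k
  proof (induction k)
    case (Suc k)
    have "a m ^ Suc k \<le> a m * a (k * m)"
      using Suc ge1[of m] by (simp add: mult_left_mono)
    also have "\<dots> \<le> a (Suc k * m)" using mult by simp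
    finally show ?case .
  qed (simp add: ge1)
  have "(\<lambda>n. root n (a n)) \<longlonglongrightarrow> L"
  proof (rule order_tendstoI)
    fix x assume "x < L"
    then obtain i where i: "x < root (Suc i) (a (Suc i))"
      using less_cSUP_iff[OF _ bdd] by (auto simp: L_def)
    define m where "m = Suc i"
    define r where "r = root m (a m)"
    have "r \<ge> 1" using ge1[of m] by (simp add: r_def m_def)
    have rm: "r ^ m = a m" using ge1[of m] real_root_pow_pos2[of m "a m"] by (simp add: r_def m_def del: power_Suc)
    have lower: "r / root n (r ^ m) \<le> root n (a n)" if "n > 0" for n
    proof -
      have "n \<le> m * (n div m) + m"
        using mod_less_divisor[of m n] mult_div_mod_eq[of m n] unfolding m_def by linarith
      then have "r ^ n \<le> r ^ (m * (n div m)) * r ^ m"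
        using \<open>r \<ge> 1\<close> by (simp add: power_increasing flip: power_add)
      then have "r ^ n / r ^ m \<le> a m ^ (n div m)"
        using \<open>r \<ge> 1\<close> ge1[of m] by (simp add: power_mult rm divide_le_eq not_less)
      also have "\<dots> \<le> a (n div m * m) * 1" using power by simp
      also have "\<dots> \<le> a (n div m * m) * a (n mod m)"
        using ge1 by (intro mult_left_mono) (auto intro: order_trans[OF zero_le_one])
      also have "\<dots> \<le> a n" using mult[of "n div m * m" "n mod m"] by simp
      finally have "root n (r ^ n / r ^ m) \<le> root n (a n)" using that by simp
      then show ?thesis
        using that \<open>r \<ge> 1\<close> by (simp add: real_root_divide real_root_power_cancel)
    qed
    have "(\<lambda>n. r / root n (r ^ m)) \<longlonglongrightarrow> r / 1"
      using \<open>r \<ge> 1\<close> by (intro tendsto_intros LIMSEQ_root_const) auto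
    then have "eventually (\<lambda>n. x < r / root n (r ^ m)) sequentially"
      using i by (intro order_tendstoD(1)) (auto simp: r_def m_def)
    then show "eventually (\<lambda>n. x < root n (a n)) sequentially"
      using eventually_gt_at_top[of 0] by eventually_elim (rule less_le_trans[OF _ lower])
  next
    fix x assume "L < x"
    show "eventually (\<lambda>n. root n (a n) < x) sequentially"
      using eventually_gt_at_top[of 0]
      by eventually_elim (rule le_less_trans[OF upper \<open>L < x\<close>])
  qed
  then show ?thesis by (rule convergentI)
qed

lemma W3_root_convergent: "convergent (\<lambda>n. root n (real (W3 n)))"
proof (rule supermultiplicative_root_convergent)
  fix n :: nat assume "n > 0"
  then have "8 * 64 ^ n \<le> 8 ^ n * (64 ^ n :: nat)"
    using power_increasing[of 1 n "8::nat"] by simp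
  also have "\<dots> = 512 ^ n" by (simp flip: power_mult_distrib)
  finally have "W3 n \<le> 512 ^ n" using W3_le[of n] by linarith
  then have "real (W3 n) \<le> real (512 ^ n)" by (simp only: of_nat_le_iff)
  then show "real (W3 n) \<le> 512 ^ n" by simp
next
  fix m n
  show "real (W3 m) * real (W3 n) \<le> real (W3 (m + n))"
    using W3_mult_le[of m n] by (simp flip: of_nat_mult)
qed (use W3_ge_1 in auto)

section \<open>Moments\<close>

definition comps :: "dtree \<Rightarrow> nat" where
  "comps t = length (cuts t) - 1"

lemma length_cuts: "length (cuts t) = Suc (comps t)"
  by (simp add: comps_def Suc_le_eq)

lemma comps_Leaf [simp]: "comps Leaf = 0"
  by (simp add: comps_def)

lemma comps_Node: "i \<le> comps r \<Longrightarrow> comps (Node l r i) = comps l + (comps r + 1 - i)"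
  by (simp add: comps_def Suc_diff_le)

lemma comps_le_nodes: "valid t \<Longrightarrow> comps t \<le> nodes t"
  by (induction t) (auto simp: comps_Node length_cuts less_Suc_eq_le)

text \<open>
  Summing \<open>weight p\<close> over the insertion positions produces the weight of index \<open>p + 1\<close> as well;
  dropping it at \<open>p = 2\<close> closes the system at the price of an inequality.
\<close>

definition weight :: "nat \<Rightarrow> nat \<Rightarrow> real" where
  "weight p c = (if p = 0 then 1 else if p = 1 then real c else real c * (real c + 1) / 2)"

lemma weight_nonneg: "weight p c \<ge> 0"
  by (simp add: weight_def)

lemma weight_le: "weight p c \<le> (real c + 1)\<^sup>2"
  by (auto simp: weight_def power2_eq_square field_simps)

text \<open>The weights are the binomial coefficients c + p - 1 over p, so this is iterated Pascal's
  rule. It applies to a root with an empty subtree, which adds exactly one component.\<close>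

lemma weight_Suc: "p \<le> 2 \<Longrightarrow> weight p (Suc c) = (\<Sum>q\<le>p. weight q c)"
  by (auto simp: weight_def le_Suc_eq numeral_2_eq_2 field_simps)

text \<open>Here \<open>a\<close> and \<open>b\<close> are the component counts of the left and
  right subtree. What is lost for \<open>p = 2\<close> is b (b + 1) (b + 2) / 6, the next binomial
  coefficient in \<open>b\<close>.\<close>

lemma sum_weight_ge:
  fixes a b :: nat
  defines "S \<equiv> \<lambda>p. \<Sum>i\<le>b. weight p (a + (b + 1 - i))"
  shows "S 0 = 1 + weight 1 b"
    and "S 1 = (1 + weight 1 b + weight 2 b) + weight 1 a * (1 + weight 1 b)"
    and "S 2 \<ge> weight 2 a * (1 + weight 1 b) + (1 + weight 1 a) * (1 + weight 1 b + weight 2 b)"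
proof -
  have S: "S p = (\<Sum>j\<le>b. weight p (a + 1 + j))" for p
    unfolding S_def by (rule sum.reindex_bij_witness[of _ "\<lambda>j. b - j" "\<lambda>i. b - i"]) (auto simp: Suc_diff_le)
  show "S 0 = 1 + weight 1 b" by (simp add: S weight_def)
  show "S 1 = (1 + weight 1 b + weight 2 b) + weight 1 a * (1 + weight 1 b)"
    unfolding S by (induction b) (auto simp: weight_def field_simps)
  have "(\<Sum>j\<le>b. weight 2 (a + 1 + j)) = weight 2 a * (1 + weight 1 b) +
      (1 + weight 1 a) * (1 + weight 1 b + weight 2 b) + real b * (real b + 1) * (real b + 2) / 6"
    by (induction b) (auto simp: weight_def field_simps)
  then show "S 2 \<ge> weight 2 a * (1 + weight 1 b) + (1 + weight 1 a) * (1 + weight 1 b + weight 2 b)"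
    unfolding S by simp
qed

section \<open>Recursion for weighted sums over trees of bounded height\<close>

fun trees :: "nat \<Rightarrow> dtree set" where
  "trees 0 = {Leaf}"
| "trees (Suc d) = insert Leaf ((\<lambda>(l, r, i). Node l r i) `
     (SIGMA l:trees d. SIGMA r:trees d. {i. i \<le> comps r \<and> (l = Leaf \<longrightarrow> i = 0)}))"

lemma finite_trees [simp]: "finite (trees d)"
proof (induction d)
  case (Suc d)
  have "finite {i. i \<le> comps r \<and> (l = Leaf \<longrightarrow> i = 0)}" for l r
    by (rule finite_subset[of _ "{..comps r}"]) auto
  with Suc show ?case by simp
qed simp

lemma Leaf_in_trees [simp]: "Leaf \<in> trees d"
  by (cases d) auto

lemma valid_trees: "t \<in> trees d \<Longrightarrow> valid t"
  by (induction d arbitrary: t) (auto simp: length_cuts less_Suc_eq_le)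

lemma Node_in_trees_Suc [simp]:
  "Node l r i \<in> trees (Suc d) \<longleftrightarrow>
    l \<in> trees d \<and> r \<in> trees d \<and> i \<le> comps r \<and> (l = Leaf \<longrightarrow> i = 0)"
proof
  assume "l \<in> trees d \<and> r \<in> trees d \<and> i \<le> comps r \<and> (l = Leaf \<longrightarrow> i = 0)"
  then show "Node l r i \<in> trees (Suc d)"
    unfolding trees.simps by (intro insertI2 image_eqI[of _ _ "(l, r, i)"]) simp_all
qed auto

declare trees.simps(2) [simp del]

lemma trees_Suc_minus_Leaf:
  "trees (Suc d) - {Leaf} = (\<lambda>(l, r, i). Node l r i) `
     (SIGMA l:trees d. SIGMA r:trees d. {i. i \<le> comps r \<and> (l = Leaf \<longrightarrow> i = 0)})"
  unfolding trees.simps(2) by (rule Diff_insert_absorb) auto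

lemma trees_mono: "trees d \<subseteq> trees (Suc d)"
proof (induction d)
  case (Suc d)
  show ?case
  proof
    fix t assume "t \<in> trees (Suc d)"
    then show "t \<in> trees (Suc (Suc d))" using Suc by (cases t) auto
  qed
qed simp

text \<open>Index 0 of \<open>f\<close> is never reached, as in \<open>tail_fertility\<close>: the
  left part always has at least the root as its tail.\<close>

definition conv :: "(nat \<Rightarrow> 'a::comm_semiring_1) \<Rightarrow> (nat \<Rightarrow> 'a) \<Rightarrow> nat \<Rightarrow> 'a" where
  "conv f g n = (\<Sum>j<n. f (n - j) * g j)"

definition psum :: "(nat \<Rightarrow> nat \<Rightarrow> 'a::comm_semiring_1) \<Rightarrow> nat \<Rightarrow> nat \<Rightarrow> 'a" where
  "psum f p n = (\<Sum>q\<le>p. f q n)"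

text \<open>Contribution of roots with exactly one empty subtree: an empty right subtree lengthens
  the tail, an empty left one contributes Catalan numbers. The prefix sums come from
  \<open>weight_Suc\<close>.\<close>

definition lin :: "(nat \<Rightarrow> nat \<Rightarrow> 'a::comm_semiring_1) \<Rightarrow> nat \<Rightarrow> nat \<Rightarrow> 'a" where
  "lin f p n = psum f p (Suc n) + conv (\<lambda>k. of_nat (catalan k)) (psum f p) n"

text \<open>Contribution of roots with two nonempty subtrees, \<open>f\<close> for the left and
  \<open>g\<close> for the right one; the coefficients are those of
  \<open>sum_weight_ge\<close>.\<close>

definition bil :: "(nat \<Rightarrow> nat \<Rightarrow> 'a::comm_semiring_1) \<Rightarrow> (nat \<Rightarrow> nat \<Rightarrow> 'a) \<Rightarrow> nat \<Rightarrow> nat \<Rightarrow> 'a" where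
  "bil f g p n =
    (if p = 0 then conv (f 0) (psum g 1) n
     else if p = 1 then conv (f 0) (psum g 2) n + conv (f 1) (psum g 1) n
     else conv (f 2) (psum g 1) n + conv (psum f 1) (psum g 2) n)"

text \<open>\<open>Leaf\<close> is left out, so that empty subtrees show up as the constant and
  linear terms of the system.\<close>

definition moment :: "real \<Rightarrow> nat \<Rightarrow> nat \<Rightarrow> nat \<Rightarrow> real" where
  "moment z d p n = (\<Sum>t\<in>trees d - {Leaf}. z ^ nodes t * weight p (comps t) * tail_fertility t n)"

lemma conv_sum:
  fixes x :: "'b \<Rightarrow> 'a::comm_semiring_1" and y :: "'c \<Rightarrow> 'a"
  shows "conv (\<lambda>n. \<Sum>l\<in>A. x l * f l n) (\<lambda>n. \<Sum>r\<in>B. y r * g r n) n =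
    (\<Sum>l\<in>A. \<Sum>r\<in>B. x l * y r * conv (f l) (g r) n)"
proof -
  have "conv (\<lambda>n. \<Sum>l\<in>A. x l * f l n) (\<lambda>n. \<Sum>r\<in>B. y r * g r n) n =
      (\<Sum>j<n. \<Sum>l\<in>A. \<Sum>r\<in>B. x l * y r * (f l (n - j) * g r j))"
    unfolding conv_def sum_product by (simp add: mult_ac)
  also have "\<dots> = (\<Sum>l\<in>A. \<Sum>j<n. \<Sum>r\<in>B. x l * y r * (f l (n - j) * g r j))"
    by (rule sum.swap)
  also have "\<dots> = (\<Sum>l\<in>A. \<Sum>r\<in>B. \<Sum>j<n. x l * y r * (f l (n - j) * g r j))"
    by (intro sum.cong refl sum.swap)
  also have "\<dots> = (\<Sum>l\<in>A. \<Sum>r\<in>B. x l * y r * conv (f l) (g r) n)"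
    by (simp add: conv_def sum_distrib_left)
  finally show ?thesis .
qed

text \<open>Trees are split by which subtrees of the root are empty: both give the Catalan number,
  exactly one gives \<open>lin\<close>, none gives \<open>bil\<close>.\<close>

lemma moment_Suc_ge:
  assumes "z \<ge> 0" "p \<le> 2"
  shows "z * (real (catalan (Suc n)) + lin (moment z d) p n + bil (moment z d) (moment z d) p n)
    \<le> moment z (Suc d) p n"
proof -
  define A where "A = trees d - {Leaf}"
  define x where "x = (\<lambda>t. z ^ nodes t)"
  define F where "F = (\<lambda>t n. real (tail_fertility t n))"
  define I where "I = (\<lambda>l r. {i. i \<le> comps r \<and> (l = Leaf \<longrightarrow> i = 0)})"
  \<comment> \<open>The preimage count does not depend on the root label, so summing over labels
    concerns the weight only.\<close>
  define W where "W = (\<lambda>l r. \<Sum>i\<in>I l r. weight p (comps l + (comps r + 1 - i)))"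
  define g where "g = (\<lambda>l r. z * (x l * x r * W l r * F (Node l r 0) n))"
  have trees: "trees d = insert Leaf A" "Leaf \<notin> A" "finite A" by (auto simp: A_def)
  have psum: "psum (moment z d) q = (\<lambda>k. \<Sum>t\<in>A. x t * (\<Sum>m\<le>q. weight m (comps t)) * F t k)" for q
    by (rule ext) (simp add: psum_def moment_def A_def x_def F_def sum_distrib_left sum_distrib_right sum.swap[of _ _ "{..q}"])
  have mom: "moment z d q = (\<lambda>k. \<Sum>t\<in>A. x t * weight q (comps t) * F t k)" for q
    by (rule ext) (simp add: moment_def A_def x_def F_def)
  have fin: "finite (I l r)" for l r
    unfolding I_def by (rule finite_subset[of _ "{..comps r}"]) auto
  have I0: "I Leaf t = {0}" "I t Leaf = {0}" for t by (auto simp: I_def)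
  have "moment z (Suc d) p n =
      (\<Sum>(l, r, i)\<in>(SIGMA l:trees d. SIGMA r:trees d. I l r).
         z ^ nodes (Node l r i) * weight p (comps (Node l r i)) * F (Node l r i) n)"
    unfolding moment_def trees_Suc_minus_Leaf
    by (subst sum.reindex) (auto simp: inj_on_def I_def F_def intro!: sum.cong)
  also have "\<dots> = (\<Sum>l\<in>trees d. \<Sum>r\<in>trees d. \<Sum>i\<in>I l r.
         z ^ nodes (Node l r i) * weight p (comps (Node l r i)) * F (Node l r i) n)"
    by (simp add: sum.Sigma fin)
  also have "\<dots> = (\<Sum>l\<in>trees d. \<Sum>r\<in>trees d. g l r)"
    unfolding g_def W_def sum_distrib_left sum_distrib_right
    by (intro sum.cong refl) (auto simp: I_def comps_Node x_def F_def power_add)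
  also have "\<dots> = g Leaf Leaf + (\<Sum>l\<in>A. g l Leaf) + (\<Sum>r\<in>A. g Leaf r) + (\<Sum>l\<in>A. \<Sum>r\<in>A. g l r)"
    using trees(2,3) by (simp add: trees(1) sum.distrib algebra_simps)
  also have "g Leaf Leaf = z * real (catalan (Suc n))"
  proof -
    have "W Leaf Leaf = weight p 1" by (simp add: W_def I0)
    then have "W Leaf Leaf = 1" by (simp add: weight_def)
    then show ?thesis by (simp add: g_def x_def F_def)
  qed
  also have "(\<Sum>l\<in>A. g l Leaf) = z * psum (moment z d) p (Suc n)"
  proof -
    have "W l Leaf = (\<Sum>m\<le>p. weight m (comps l))" for l
      by (simp add: W_def I0 weight_Suc[OF assms(2)])
    then show ?thesis by (simp add: g_def psum x_def F_def sum_distrib_left mult_ac)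
  qed
  also have "(\<Sum>r\<in>A. g Leaf r) = z * conv (\<lambda>k. of_nat (catalan k)) (psum (moment z d) p) n"
  proof -
    have W: "W Leaf r = (\<Sum>m\<le>p. weight m (comps r))" for r
      by (simp add: W_def I0 weight_Suc[OF assms(2)])
    have "conv (\<lambda>k. of_nat (catalan k)) (psum (moment z d) p) n =
        conv (\<lambda>k. \<Sum>l\<in>{Leaf}. 1 * of_nat (catalan k)) (psum (moment z d) p) n" by simp
    also have "\<dots> = (\<Sum>r\<in>A. x r * W Leaf r * conv (\<lambda>k. of_nat (catalan k)) (F r) n)"
      unfolding psum W by (subst conv_sum) simp
    also have "\<dots> = (\<Sum>r\<in>A. x r * W Leaf r * F (Node Leaf r 0) n)"
      by (intro sum.cong refl) (auto simp: A_def F_def conv_def)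
    finally show ?thesis by (simp add: g_def x_def sum_distrib_left)
  qed
  finally have "moment z (Suc d) p n = z * real (catalan (Suc n)) + z * psum (moment z d) p (Suc n) +
      z * conv (\<lambda>k. of_nat (catalan k)) (psum (moment z d) p) n + (\<Sum>l\<in>A. \<Sum>r\<in>A. g l r)" .
  moreover have "(\<Sum>l\<in>A. \<Sum>r\<in>A. g l r) \<ge> z * bil (moment z d) (moment z d) p n"
  proof -
    define u where "u = (\<lambda>q t. \<Sum>m\<le>q. weight m (comps t))"
    define v where "v = (\<lambda>q t. weight q (comps t))"
    define B where "B = (\<lambda>l r. if p = 0 then v 0 l * u 1 r else if p = 1 then v 0 l * u 2 r + v 1 l * u 1 r
      else v 2 l * u 1 r + u 1 l * u 2 r)"
    have u: "u 1 t = 1 + weight 1 (comps t)" "u 2 t = 1 + weight 1 (comps t) + weight 2 (comps t)" for t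
      by (simp_all add: u_def weight_def numeral_2_eq_2)
    have "bil (moment z d) (moment z d) p n = (\<Sum>l\<in>A. \<Sum>r\<in>A. x l * x r * B l r * conv (F l) (F r) n)"
      unfolding bil_def psum unfolding mom conv_sum B_def u_def v_def
      by (simp add: sum.distrib algebra_simps)
    also have "z * \<dots> = (\<Sum>l\<in>A. \<Sum>r\<in>A. z * (x l * x r * B l r * conv (F l) (F r) n))"
      by (simp add: sum_distrib_left)
    also have "\<dots> \<le> (\<Sum>l\<in>A. \<Sum>r\<in>A. g l r)"
    proof (intro sum_mono)
      fix l r assume lr: "l \<in> A" "r \<in> A"
      then have "W l r = (\<Sum>i\<le>comps r. weight p (comps l + (comps r + 1 - i)))"
        by (simp add: W_def I_def A_def atMost_def)
      moreover have "p = 0 \<or> p = 1 \<or> p = 2" using assms(2) by linarith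
      ultimately have "B l r \<le> W l r"
        using sum_weight_ge[where a = "comps l" and b = "comps r"]
        by (elim disjE) (simp_all add: B_def u v_def weight_def[of 0] del: One_nat_def)
      moreover have "conv (F l) (F r) n = F (Node l r 0) n"
        using lr by (auto simp: A_def F_def conv_def)
      moreover have "F (Node l r 0) n \<ge> 0" by (simp add: F_def)
      ultimately show "z * (x l * x r * B l r * conv (F l) (F r) n) \<le> g l r"
        unfolding g_def using assms(1) by (auto intro!: mult_left_mono mult_right_mono simp: x_def)
    qed
    finally show ?thesis .
  qed
  ultimately show ?thesis by (simp add: lin_def distrib_left del: catalan.simps)
qed

section \<open>Monotonicity and finiteness of the moments\<close>

lemma moment_nonneg: "z \<ge> 0 \<Longrightarrow> moment z d p n \<ge> 0"
  unfolding moment_def by (intro sum_nonneg mult_nonneg_nonneg weight_nonneg) auto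

lemma moment_mono: "z \<ge> 0 \<Longrightarrow> moment z d p n \<le> moment z (Suc d) p n"
  unfolding moment_def using trees_mono
  by (intro sum_mono2 mult_nonneg_nonneg weight_nonneg) auto

text \<open>A tail of \<open>n\<close> entries is absorbed as \<open>n\<close> new roots with empty
  right subtree.\<close>

lemma sum_tail_fertility_le:
  assumes "finite T" "\<And>t. t \<in> T \<Longrightarrow> valid t \<and> nodes t = m"
  shows "(\<Sum>t\<in>T. tail_fertility t n) \<le> W3 (m + n)"
  using assms
proof (induction n arbitrary: m T)
  case 0
  then show ?case using sum_tail_fertility_le_W3[of T m] by simp
next
  case (Suc n)
  let ?h = "\<lambda>t. Node t Leaf 0"
  have "(\<Sum>t\<in>T. tail_fertility t (Suc n)) = (\<Sum>t\<in>?h ` T. tail_fertility t n)"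
    by (subst sum.reindex) (auto simp: inj_on_def)
  also have "\<dots> \<le> W3 (Suc m + n)"
    using Suc.prems by (intro Suc.IH) auto
  finally show ?case by simp
qed

lemma moment_le:
  assumes "z \<ge> 0" "summable (\<lambda>m. (real m + 1)\<^sup>2 * real (W3 (m + n)) * z ^ m)"
  shows "moment z d p n \<le> (\<Sum>m. (real m + 1)\<^sup>2 * real (W3 (m + n)) * z ^ m)"
proof -
  have "moment z d p n \<le> (\<Sum>t\<in>trees d. z ^ nodes t * (real (nodes t) + 1)\<^sup>2 * tail_fertility t n)"
    unfolding moment_def
  proof (rule order_trans[OF sum_mono sum_mono2])
    fix t assume "t \<in> trees d - {Leaf}"
    then have "comps t \<le> nodes t" using valid_trees comps_le_nodes by blast
    then have "(real (comps t) + 1)\<^sup>2 \<le> (real (nodes t) + 1)\<^sup>2" by (intro power_mono) auto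
    then have "weight p (comps t) \<le> (real (nodes t) + 1)\<^sup>2" using weight_le order_trans by blast
    then show "z ^ nodes t * weight p (comps t) * tail_fertility t n
        \<le> z ^ nodes t * (real (nodes t) + 1)\<^sup>2 * tail_fertility t n"
      using assms(1) by (intro mult_right_mono mult_left_mono) auto
  qed (use assms(1) in auto)
  also have "\<dots> = (\<Sum>m\<in>nodes ` trees d. \<Sum>t\<in>{t \<in> trees d. nodes t = m}.
      z ^ nodes t * (real (nodes t) + 1)\<^sup>2 * tail_fertility t n)"
    by (rule sum.image_gen) simp
  also have "\<dots> = (\<Sum>m\<in>nodes ` trees d. z ^ m * (real m + 1)\<^sup>2 *
      real (\<Sum>t\<in>{t \<in> trees d. nodes t = m}. tail_fertility t n))"
    by (simp add: sum_distrib_left)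
  also have "\<dots> \<le> (\<Sum>m\<in>nodes ` trees d. z ^ m * (real m + 1)\<^sup>2 * real (W3 (m + n)))"
    using assms(1) valid_trees
    by (intro sum_mono mult_left_mono) (auto simp del: of_nat_sum intro!: sum_tail_fertility_le)
  also have "\<dots> = (\<Sum>m\<in>nodes ` trees d. (real m + 1)\<^sup>2 * real (W3 (m + n)) * z ^ m)"
    by (simp add: mult_ac)
  also have "\<dots> \<le> (\<Sum>m. (real m + 1)\<^sup>2 * real (W3 (m + n)) * z ^ m)"
    using assms by (intro sum_le_suminf) auto
  finally show ?thesis .
qed

lemma summable_W3_moment:
  assumes "z \<ge> 0" "q * z < 1" "q > 0" "lim (\<lambda>n. root n (real (W3 n))) < q"
  shows "summable (\<lambda>m. (real m + 1)\<^sup>2 * real (W3 (m + n)) * z ^ m)"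
proof -
  \<comment> \<open>One factor \<open>s ^ m\<close> of \<open>(q * z) ^ m\<close> absorbs one of the
    two factors \<open>m + 1\<close> into the constant \<open>K\<close>; what remains is a
    convergent series.\<close>
  define s where "s = sqrt (q * z)"
  have s: "0 \<le> s" "s < 1" "s * s = q * z" using assms by (auto simp: s_def)
  have sums: "summable (\<lambda>m. real (Suc m) * s ^ m)"
    using geometric_deriv_sums[of s] s by (simp add: sums_iff)
  define K where "K = (\<Sum>m. real (Suc m) * s ^ m)"
  have K: "real (Suc m) * s ^ m \<le> K" for m
    unfolding K_def using sum_le_suminf[OF sums, of "{m}"] s(1) by simp
  have "eventually (\<lambda>n. root n (real (W3 n)) < q) sequentially"
    using W3_root_convergent assms(4) by (intro order_tendstoD(2)) (simp_all add: convergent_LIMSEQ_iff)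
  then obtain N where N: "root m (real (W3 m)) < q" if "m \<ge> N" for m
    unfolding eventually_sequentially by blast
  have W3: "real (W3 m) \<le> q ^ m" if "m \<ge> Suc N" for m
  proof -
    have "real (W3 m) = root m (real (W3 m)) ^ m"
      using that by (simp add: real_root_pow_pos2)
    also have "\<dots> \<le> q ^ m" using N[of m] that by (intro power_mono) auto
    finally show ?thesis .
  qed
  have "norm ((real m + 1)\<^sup>2 * real (W3 (m + n)) * z ^ m) \<le> q ^ n * K * (real (Suc m) * s ^ m)"
    if "m \<ge> Suc N" for m
  proof -
    have "(real m + 1)\<^sup>2 * real (W3 (m + n)) * z ^ m \<le> (real m + 1)\<^sup>2 * q ^ (m + n) * z ^ m"
      using W3[of "m + n"] that assms(1) by (intro mult_right_mono mult_left_mono) auto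
    also have "\<dots> = q ^ n * ((real m + 1) * (real m + 1) * (q * z) ^ m)"
      by (simp add: power_add power2_eq_square power_mult_distrib mult_ac)
    also have "(q * z) ^ m = s ^ m * s ^ m"
      by (simp only: s(3)[symmetric] power_mult_distrib)
    also have "q ^ n * ((real m + 1) * (real m + 1) * (s ^ m * s ^ m)) =
        q ^ n * ((real (Suc m) * s ^ m) * (real (Suc m) * s ^ m))"
      by (simp add: mult_ac add_ac)
    also have "\<dots> \<le> q ^ n * (K * (real (Suc m) * s ^ m))"
      using K assms(3) s(1) by (intro mult_left_mono mult_right_mono) auto
    finally show ?thesis using assms(1) by (simp add: mult_ac)
  qed
  then show ?thesis
    by (intro summable_comparison_test[OF _ summable_mult[OF sums]]) blast
qed

section \<open>The numerical lower bound\<close>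

lemma conv_add_left: "conv (\<lambda>n. f n + g n) h n = conv f h n + conv g h n"
  by (simp add: conv_def distrib_right sum.distrib)

lemma conv_add_right: "conv h (\<lambda>n. f n + g n) n = conv h f n + conv h g n"
  by (simp add: conv_def distrib_left sum.distrib)

lemma conv_scale_left: "conv (\<lambda>n. c * f n) h n = c * conv f h n"
  by (simp add: conv_def sum_distrib_left mult_ac)

lemma conv_scale_right: "conv h (\<lambda>n. c * f n) n = c * conv h f n"
  by (simp add: conv_def sum_distrib_left mult_ac)

lemma psum_add: "psum (\<lambda>p n. f p n + g p n) p = (\<lambda>n. psum f p n + psum g p n)"
  by (rule ext) (simp add: psum_def sum.distrib)

lemma psum_scale: "psum (\<lambda>p n. c * f p n) p = (\<lambda>n. c * psum f p n)"
  by (rule ext) (simp add: psum_def sum_distrib_left)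

lemma lin_add: "lin (\<lambda>p n. f p n + g p n) p n = lin f p n + lin g p n"
  by (simp add: lin_def psum_add conv_add_right add_ac)

lemma lin_scale: "lin (\<lambda>p n. c * f p n) p n = c * lin f p n"
  by (simp add: lin_def psum_scale conv_scale_right distrib_left)

lemma bil_add_left: "bil (\<lambda>p n. f p n + g p n) h p n = bil f h p n + bil g h p n"
  by (simp add: bil_def psum_add conv_add_left add_ac)

lemma bil_add_right: "bil h (\<lambda>p n. f p n + g p n) p n = bil h f p n + bil h g p n"
  by (simp add: bil_def psum_add conv_add_right add_ac)

lemma bil_scale_left: "bil (\<lambda>p n. c * f p n) h p n = c * bil f h p n"
  by (simp add: bil_def psum_scale conv_scale_left distrib_left)

lemma bil_scale_right: "bil h (\<lambda>p n. c * f p n) p n = c * bil h f p n"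
  by (simp add: bil_def psum_scale conv_scale_right distrib_left)

lemma conv_mono:
  fixes f g f' g' :: "nat \<Rightarrow> real"
  assumes "\<And>n. 0 \<le> f n" "\<And>n. 0 \<le> g n" "\<And>n. f n \<le> f' n" "\<And>n. g n \<le> g' n"
  shows "conv f g n \<le> conv f' g' n"
  unfolding conv_def using assms by (intro sum_mono mult_mono) (auto intro: order_trans)

lemma psum_mono:
  fixes f g :: "nat \<Rightarrow> nat \<Rightarrow> real"
  assumes "\<And>p n. p \<le> 2 \<Longrightarrow> f p n \<le> g p n" "p \<le> 2"
  shows "psum f p n \<le> psum g p n"
  unfolding psum_def using assms by (intro sum_mono) auto

lemma psum_nonneg:
  fixes f :: "nat \<Rightarrow> nat \<Rightarrow> real"
  assumes "\<And>p n. p \<le> 2 \<Longrightarrow> 0 \<le> f p n" "p \<le> 2"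
  shows "0 \<le> psum f p n"
  unfolding psum_def using assms by (intro sum_nonneg) auto

lemma lin_mono:
  fixes f g :: "nat \<Rightarrow> nat \<Rightarrow> real"
  assumes "\<And>p n. p \<le> 2 \<Longrightarrow> 0 \<le> f p n" "\<And>p n. p \<le> 2 \<Longrightarrow> f p n \<le> g p n" "p \<le> 2"
  shows "lin f p n \<le> lin g p n"
  unfolding lin_def using assms by (intro add_mono conv_mono psum_mono psum_nonneg) auto

lemma bil_mono:
  fixes f g f' g' :: "nat \<Rightarrow> nat \<Rightarrow> real"
  assumes "\<And>p n. p \<le> 2 \<Longrightarrow> 0 \<le> f p n" "\<And>p n. p \<le> 2 \<Longrightarrow> 0 \<le> g p n"
    and "\<And>p n. p \<le> 2 \<Longrightarrow> f p n \<le> f' p n" "\<And>p n. p \<le> 2 \<Longrightarrow> g p n \<le> g' p n"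
  shows "bil f g p n \<le> bil f' g' p n"
  unfolding bil_def using assms
  by (auto intro!: add_mono conv_mono psum_mono psum_nonneg)

lemma bil_nonneg:
  fixes f g :: "nat \<Rightarrow> nat \<Rightarrow> real"
  assumes "\<And>p n. p \<le> 2 \<Longrightarrow> 0 \<le> f p n" "\<And>p n. p \<le> 2 \<Longrightarrow> 0 \<le> g p n"
  shows "0 \<le> bil f g p n"
proof -
  \<comment> \<open>Zero is written as \<open>0 * f p n\<close> so that the scaling law evaluates
    the left-hand side.\<close>
  have "bil (\<lambda>p n. 0 * f p n) g p n \<le> bil f g p n"
    using assms by (intro bil_mono) auto
  then show ?thesis unfolding bil_scale_left by simp
qed

lemma lin_nonneg:
  fixes f :: "nat \<Rightarrow> nat \<Rightarrow> real"
  assumes "\<And>p n. p \<le> 2 \<Longrightarrow> 0 \<le> f p n" "p \<le> 2"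
  shows "0 \<le> lin f p n"
proof -
  have "lin (\<lambda>p n. 0 * f p n) p n \<le> lin f p n"
    using assms by (intro lin_mono) auto
  then show ?thesis unfolding lin_scale by simp
qed

section \<open>Integer arithmetic on truncated sequences\<close>

definition coefs :: "int list \<Rightarrow> nat \<Rightarrow> real" where
  "coefs xs n = (if n < length xs then real_of_int (xs ! n) else 0)"

text \<open>Twelve values serve the range \<open>n < 11\<close>, since the constant term is
  \<open>catalan (Suc n)\<close>.\<close>

definition cat_list :: "int list" where
  "cat_list = [1, 1, 2, 5, 14, 42, 132, 429, 1430, 4862, 16796, 58786]"

definition add_list :: "int list \<Rightarrow> int list \<Rightarrow> int list" where
  "add_list = map2 (+)"

definition conv_list :: "int list \<Rightarrow> int list \<Rightarrow> int list" where
  "conv_list xs ys = map (\<lambda>n. sum_list (map2 (*) (rev (take n (tl xs))) (take n ys))) [0..<length ys]"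

lemma length_cat_list [simp]: "length cat_list = 12"
  by (simp add: cat_list_def)

lemma length_add_list [simp]: "length (add_list xs ys) = min (length xs) (length ys)"
  by (simp add: add_list_def)

lemma length_conv_list [simp]: "length (conv_list xs ys) = length ys"
  by (simp add: conv_list_def)

lemma coefs_add: "length xs = length ys \<Longrightarrow> coefs (add_list xs ys) n = coefs xs n + coefs ys n"
  by (simp add: coefs_def add_list_def)

text \<open>The appended 0 keeps the length and agrees with the convention that coefficients beyond
  the list vanish.\<close>

lemma coefs_shift: "xs \<noteq> [] \<Longrightarrow> coefs (tl xs @ [0]) n = coefs xs (Suc n)"
  by (cases xs) (auto simp: coefs_def nth_append less_Suc_eq)

lemma coefs_conv:
  assumes "length ys \<le> length xs" "n < length ys"
  shows "coefs (conv_list xs ys) n = conv (coefs xs) (coefs ys) n"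
proof -
  have "sum_list (map2 (*) (rev (take n (tl xs))) (take n ys)) = (\<Sum>j<n. xs ! (n - j) * ys ! j)"
    using assms by (subst sum_list_sum_nth) (auto simp: rev_nth nth_tl Suc_diff_Suc atLeast0LessThan intro!: sum.cong)
  then show ?thesis
    using assms by (auto simp: coefs_def conv_list_def conv_def intro!: sum.cong)
qed

lemma cat_list_recursion:
  "\<forall>n\<in>set [0..<11]. cat_list ! Suc n =
     sum_list (map (\<lambda>k. cat_list ! k * cat_list ! (n - k)) [0..<Suc n])"
  by code_simp

lemma coefs_cat_list:
  assumes "n < 12"
  shows "coefs cat_list n = real (catalan n)"
proof -
  have "cat_list ! n = int (catalan n)"
    using assms
  proof (induction n rule: less_induct)
    case (less n)
    show ?case
    proof (cases n)
      case 0
      then show ?thesis by (simp add: cat_list_def)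
    next
      case (Suc m)
      have "cat_list ! Suc m = (\<Sum>k\<le>m. cat_list ! k * cat_list ! (m - k))"
        using cat_list_recursion less.prems Suc
        by (simp add: interv_sum_list_conv_sum_set_nat atLeast0LessThan lessThan_Suc_atMost del: upt_Suc sum.atMost_Suc)
      also have "\<dots> = int (catalan (Suc m))"
        using less Suc by simp
      finally show ?thesis using Suc by simp
    qed
  qed
  then show ?thesis using assms by (simp add: coefs_def)
qed

type_synonym layers = "int list \<times> int list \<times> int list"

fun psum_layers :: "layers \<Rightarrow> layers" where
  "psum_layers (a, b, c) = (let ab = add_list a b in (a, ab, add_list ab c))"

fun lin_layers :: "layers \<Rightarrow> layers" where
  "lin_layers f = (case psum_layers f of (a, b, c) \<Rightarrow>
     (let h = (\<lambda>v. add_list (tl v @ [0]) (conv_list cat_list v)) in (h a, h b, h c)))"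

fun bil_layers :: "layers \<Rightarrow> layers \<Rightarrow> layers" where
  "bil_layers (a, b, c) g = (case psum_layers g of (_, s1, s2) \<Rightarrow>
     (conv_list a s1, add_list (conv_list a s2) (conv_list b s1),
      add_list (conv_list c s1) (conv_list (add_list a b) s2)))"

text \<open>
  Fixed-point arithmetic with denominator \<open>scale\<close>; the factor \<open>3 / 26\<close> is the value of \<open>z\<close>,
  chosen with \<open>8.659702 < 26 / 3\<close>.
\<close>

definition scale :: int where "scale = 100000"

text \<open>One step of the system. The bilinear part has denominator \<open>scale * scale\<close>,
  so the other terms are brought to it before a single division, which rounds down.\<close>

fun next_layers :: "layers \<Rightarrow> layers" where
  "next_layers f = (case lin_layers f of (l0, l1, l2) \<Rightarrow> case bil_layers f f of (b0, b1, b2) \<Rightarrow>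
     (let h = (\<lambda>l b. map2 (\<lambda>x y. 3 * (scale * x + y) div (26 * scale))
        (add_list (map ((*) scale) (tl cat_list)) l) b) in (h l0 b0, h l1 b1, h l2 b2)))"

fun diff_layers :: "layers \<Rightarrow> layers \<Rightarrow> layers" where
  "diff_layers (a, b, c) (a', b', c') = (map2 (-) a' a, map2 (-) b' b, map2 (-) c' c)"

text \<open>The direction must be positive in every coordinate and must not shrink under the
  derivative of the system at \<open>f\<close>; \<open>bil\<close> contributes two terms to this
  derivative.\<close>

fun expanding :: "layers \<Rightarrow> layers \<Rightarrow> bool" where
  "expanding f (e0, e1, e2) = (case lin_layers (e0, e1, e2) of (l0, l1, l2) \<Rightarrow>
     case bil_layers f (e0, e1, e2) of (b0, b1, b2) \<Rightarrow> case bil_layers (e0, e1, e2) f of (c0, c1, c2) \<Rightarrow>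
     (let h = (\<lambda>e l b c. list_all (\<lambda>(x, y, u, v). 0 < x \<and> 26 * scale * x \<le> 3 * (scale * y + u + v))
          (zip e (zip l (zip b c))))
      in h e0 l0 b0 c0 \<and> h e1 l1 b1 c1 \<and> h e2 l2 b2 c2))"

text \<open>The arguments are consecutive iterates, so each is computed only once; the direction
  tested is the last increment.\<close>

fun eventually_expanding :: "nat \<Rightarrow> layers \<Rightarrow> layers \<Rightarrow> bool" where
  "eventually_expanding 0 f g = expanding f (diff_layers f g)"
| "eventually_expanding (Suc n) f g = eventually_expanding n g (next_layers g)"

definition zero_layers :: layers where
  "zero_layers = (replicate 11 0, replicate 11 0, replicate 11 0)"

definition layer :: "layers \<Rightarrow> nat \<Rightarrow> int list" where
  "layer f p = (if p = 0 then fst f else if p = 1 then fst (snd f) else snd (snd f))"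

definition entry :: "layers \<Rightarrow> nat \<Rightarrow> nat \<Rightarrow> real" where
  "entry f p = coefs (layer f p)"

definition full :: "layers \<Rightarrow> bool" where
  "full f \<longleftrightarrow> length (fst f) = 11 \<and> length (fst (snd f)) = 11 \<and> length (snd (snd f)) = 11"

lemma full_psum: "full f \<Longrightarrow> full (psum_layers f)"
  by (cases f) (auto simp: full_def Let_def)

lemma entry_psum: "full f \<Longrightarrow> p \<le> 2 \<Longrightarrow> entry (psum_layers f) p n = psum (entry f) p n"
  by (cases f) (auto simp: full_def Let_def psum_def entry_def layer_def coefs_add le_Suc_eq
      numeral_2_eq_2)

lemma layer_lin: "p \<le> 2 \<Longrightarrow> layer (lin_layers f) p =
    add_list (tl (layer (psum_layers f) p) @ [0]) (conv_list cat_list (layer (psum_layers f) p))"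
  by (auto simp: layer_def Let_def split: prod.splits)

lemma length_layer: "full f \<Longrightarrow> length (layer f p) = 11"
  by (auto simp: full_def layer_def)

lemma entry_lin:
  assumes "full f" "p \<le> 2" "n < 11"
  shows "entry (lin_layers f) p n = lin (entry f) p n"
proof -
  define s where "s = layer (psum_layers f) p"
  have s: "length s = 11" unfolding s_def using assms by (intro length_layer full_psum)
  have cs: "coefs s = psum (entry f) p"
    using entry_psum[OF assms(1,2)] by (auto simp: entry_def s_def)
  have "conv (coefs cat_list) (coefs s) n = conv (\<lambda>k. of_nat (catalan k)) (coefs s) n"
    unfolding conv_def using assms(3) by (intro sum.cong) (auto simp: coefs_cat_list)
  moreover have "coefs (tl s @ [0]) n = coefs s (Suc n)" using s by (intro coefs_shift) auto
  ultimately have "coefs (add_list (tl s @ [0]) (conv_list cat_list s)) n =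
      coefs s (Suc n) + conv (\<lambda>k. of_nat (catalan k)) (coefs s) n"
    using s assms(3) by (simp add: coefs_add coefs_conv)
  then show ?thesis
    unfolding entry_def layer_lin[OF assms(2)] lin_def s_def[symmetric] cs[symmetric] .
qed

lemma full_lin: "full f \<Longrightarrow> full (lin_layers f)"
  using full_psum[of f] by (cases "psum_layers f") (auto simp: full_def Let_def)

lemma full_bil: "full f \<Longrightarrow> full g \<Longrightarrow> full (bil_layers f g)"
  using full_psum[of g] by (cases f; cases "psum_layers g") (auto simp: full_def)

lemma entry_bil:
  assumes "full f" "full g" "p \<le> 2" "n < 11"
  shows "entry (bil_layers f g) p n = bil (entry f) (entry g) p n"
proof -
  obtain a b c where f: "f = (a, b, c)" by (cases f)
  obtain s0 s1 s2 where s: "psum_layers g = (s0, s1, s2)" by (cases "psum_layers g")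
  have len: "length a = 11" "length b = 11" "length c = 11" "length s1 = 11" "length s2 = 11"
    using assms(1) full_psum[OF assms(2)] by (auto simp: f s full_def)
  have p1: "psum (entry g) 1 = coefs s1" and p2: "psum (entry g) 2 = coefs s2"
    using entry_psum[OF assms(2), of 1] entry_psum[OF assms(2), of 2]
    by (auto simp: s entry_def layer_def)
  have f1: "psum (entry f) 1 = coefs (add_list a b)"
    using len by (auto simp: psum_def entry_def layer_def f coefs_add)
  have e: "entry f 0 = coefs a" "entry f 1 = coefs b" "entry f 2 = coefs c"
    by (simp_all add: entry_def layer_def f)
  have "p = 0 \<or> p = 1 \<or> p = 2" using assms(3) by linarith
  then show ?thesis
    unfolding bil_def p1 p2 f1 e
    using len assms(4) by (elim disjE) (simp_all add: entry_def layer_def f s coefs_add coefs_conv)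
qed

declare psum_layers.simps [simp del] lin_layers.simps [simp del] bil_layers.simps [simp del]

lemma entry_outside: "full f \<Longrightarrow> n \<ge> 11 \<Longrightarrow> entry f p n = 0"
  using length_layer[of f p] by (simp add: entry_def coefs_def)

lemma entry_inside: "full f \<Longrightarrow> n < 11 \<Longrightarrow> entry f p n = real_of_int (layer f p ! n)"
  using length_layer[of f p] by (simp add: entry_def coefs_def)

lemma entry_next_layers:
  assumes "full f" "p \<le> 2" "n < 11"
  shows "layer (next_layers f) p ! n =
    3 * (scale * (scale * cat_list ! Suc n + layer (lin_layers f) p ! n) + layer (bil_layers f f) p ! n)
      div (26 * scale)" and "full (next_layers f)"
proof -
  obtain l0 l1 l2 where l: "lin_layers f = (l0, l1, l2)" by (cases "lin_layers f")
  obtain b0 b1 b2 where b: "bil_layers f f = (b0, b1, b2)" by (cases "bil_layers f f")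
  have len: "length l0 = 11" "length l1 = 11" "length l2 = 11" "length b0 = 11" "length b1 = 11" "length b2 = 11"
    using full_lin[OF assms(1)] full_bil[OF assms(1,1)] by (auto simp: l b full_def)
  have "p = 0 \<or> p = 1 \<or> p = 2" using assms(2) by linarith
  then show "layer (next_layers f) p ! n =
    3 * (scale * (scale * cat_list ! Suc n + layer (lin_layers f) p ! n) + layer (bil_layers f f) p ! n)
      div (26 * scale)"
    using len assms(3) by (elim disjE) (simp_all add: layer_def l b Let_def add_list_def nth_tl)
  show "full (next_layers f)"
    using len by (simp add: full_def l b Let_def)
qed

declare next_layers.simps [simp del]

lemma layer_diff_layers:
  assumes "full f" "full g" "n < 11"
  shows "layer (diff_layers f g) p ! n = layer g p ! n - layer f p ! n" and "full (diff_layers f g)"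
  using assms by (cases f; cases g; simp add: layer_def full_def)+

lemma expanding_iff:
  assumes "full f" "full e" "expanding f e" "p \<le> 2" "n < 11"
  shows "0 < layer e p ! n" and "26 * scale * layer e p ! n \<le>
    3 * (scale * layer (lin_layers e) p ! n + layer (bil_layers f e) p ! n + layer (bil_layers e f) p ! n)"
proof -
  obtain e0 e1 e2 where e: "e = (e0, e1, e2)" by (cases e)
  obtain l0 l1 l2 where l: "lin_layers e = (l0, l1, l2)" by (cases "lin_layers e")
  obtain b0 b1 b2 where b: "bil_layers f e = (b0, b1, b2)" by (cases "bil_layers f e")
  obtain c0 c1 c2 where c: "bil_layers e f = (c0, c1, c2)" by (cases "bil_layers e f")
  have len: "length e0 = 11" "length e1 = 11" "length e2 = 11" "length l0 = 11" "length l1 = 11" "length l2 = 11"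
    "length b0 = 11" "length b1 = 11" "length b2 = 11" "length c0 = 11" "length c1 = 11" "length c2 = 11"
    using assms(2) full_lin[OF assms(2)] full_bil[OF assms(1,2)] full_bil[OF assms(2,1)]
    by (auto simp: l b c full_def) (auto simp: e)
  have "p = 0 \<or> p = 1 \<or> p = 2" using assms(4) by linarith
  then have "0 < layer e p ! n \<and> 26 * scale * layer e p ! n \<le>
    3 * (scale * layer (lin_layers e) p ! n + layer (bil_layers f e) p ! n + layer (bil_layers e f) p ! n)"
    using assms(3) l[unfolded e] b[unfolded e] c[unfolded e] len assms(5)
    by (elim disjE) (auto simp: e layer_def Let_def list_all_length)
  then show "0 < layer e p ! n" and "26 * scale * layer e p ! n \<le>
    3 * (scale * layer (lin_layers e) p ! n + layer (bil_layers f e) p ! n + layer (bil_layers e f) p ! n)"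
    by auto
qed

section \<open>Comparison of the iterates with a supersolution\<close>

context
  fixes g :: "nat \<Rightarrow> nat \<Rightarrow> real"
  assumes nonneg: "\<And>p n. p \<le> 2 \<Longrightarrow> 0 \<le> g p n"
    and super: "\<And>p n. p \<le> 2 \<Longrightarrow> 3 / 26 * (real (catalan (Suc n)) + lin g p n + bil g g p n) \<le> g p n"
begin

definition below :: "layers \<Rightarrow> bool" where
  "below f \<longleftrightarrow> full f \<and> (\<forall>p\<le>2. \<forall>n. 0 \<le> entry f p n \<and> entry f p n \<le> real_of_int scale * g p n)"

definition scaled :: "layers \<Rightarrow> nat \<Rightarrow> nat \<Rightarrow> real" where
  "scaled f p n = 1 / real_of_int scale * entry f p n"

lemma lin_scaled: "full f \<Longrightarrow> p \<le> 2 \<Longrightarrow> n < 11 \<Longrightarrow>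
    lin (scaled f) p n = real_of_int (layer (lin_layers f) p ! n) / real_of_int scale"
  using entry_lin[of f p n] entry_inside[OF full_lin, of f n p]
  unfolding scaled_def lin_scale by simp

lemma bil_scaled: "full f \<Longrightarrow> full h \<Longrightarrow> p \<le> 2 \<Longrightarrow> n < 11 \<Longrightarrow>
    bil (scaled f) (scaled h) p n =
      real_of_int (layer (bil_layers f h) p ! n) / (real_of_int scale * real_of_int scale)"
  using entry_bil[of f h p n] entry_inside[OF full_bil, of f h n p]
  unfolding scaled_def bil_scale_left bil_scale_right by simp

text \<open>Integer division rounds down, so the computed step never exceeds the exact one.\<close>

lemma next_layers_le:
  assumes "full f" "p \<le> 2" "n < 11"
  shows "scaled (next_layers f) p n \<le>
    3 / 26 * (real (catalan (Suc n)) + lin (scaled f) p n + bil (scaled f) (scaled f) p n)"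
proof -
  define s where "s = real_of_int scale"
  have s: "s > 0" by (simp add: s_def scale_def)
  let ?x = "3 * (scale * (scale * cat_list ! Suc n + layer (lin_layers f) p ! n) + layer (bil_layers f f) p ! n)"
  have c: "real_of_int (cat_list ! Suc n) = real (catalan (Suc n))"
    using coefs_cat_list[of "Suc n"] assms(3) by (simp add: coefs_def del: catalan.simps)
  have "real_of_int (?x div (26 * scale)) \<le> real_of_int ?x / real_of_int (26 * scale)"
    by (rule real_of_int_div4)
  also have "\<dots> = s * (3 / 26 * (real (catalan (Suc n)) + lin (scaled f) p n + bil (scaled f) (scaled f) p n))"
    using s unfolding lin_scaled[OF assms] bil_scaled[OF assms(1,1,2,3)] s_def[symmetric]
    by (simp add: c s_def[symmetric] field_simps del: catalan.simps)
  finally show ?thesis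
    using s entry_next_layers(1)[OF assms] entry_inside[OF entry_next_layers(2)[OF assms], of n p] assms(3)
    unfolding scaled_def s_def[symmetric] by (simp add: field_simps del: catalan.simps)
qed

lemma below_scaled:
  assumes "below f" "p \<le> 2"
  shows "0 \<le> scaled f p n" "scaled f p n \<le> g p n"
  using assms by (auto simp: below_def scaled_def scale_def field_simps)

text \<open>The operators are monotone on nonnegative sequences, so the step from \<open>f\<close>
  is at most the step from \<open>g\<close>, which is at most \<open>g\<close> by
  \<open>super\<close>.\<close>

lemma below_next_layers:
  assumes "below f"
  shows "below (next_layers f)"
proof -
  have f: "full f" using assms by (simp add: below_def)
  have full: "full (next_layers f)" by (rule entry_next_layers(2)[OF f, of 0 0]) auto
  have "0 \<le> entry (next_layers f) p n \<and> entry (next_layers f) p n \<le> real_of_int scale * g p n"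
    if p: "p \<le> 2" for p n
  proof (cases "n < 11")
    case True
    have "0 \<le> lin (scaled f) p n" "0 \<le> bil (scaled f) (scaled f) p n"
      using below_scaled[OF assms] p by (auto intro!: lin_nonneg bil_nonneg)
    then have "0 \<le> layer (lin_layers f) p ! n" "0 \<le> layer (bil_layers f f) p ! n"
      using p True f by (auto simp: lin_scaled bil_scaled scale_def zero_le_divide_iff)
    moreover have "0 \<le> cat_list ! Suc n"
      using coefs_cat_list[of "Suc n"] True by (simp add: coefs_def del: catalan.simps)
    ultimately have "0 \<le> layer (next_layers f) p ! n"
      unfolding entry_next_layers(1)[OF f p True] by (simp add: scale_def pos_imp_zdiv_nonneg_iff)
    then have "0 \<le> entry (next_layers f) p n" using full True by (simp add: entry_inside)
    moreover have "scaled (next_layers f) p n \<le> g p n"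
    proof -
      have "3 / 26 * (real (catalan (Suc n)) + lin (scaled f) p n + bil (scaled f) (scaled f) p n) \<le>
          3 / 26 * (real (catalan (Suc n)) + lin g p n + bil g g p n)"
        using below_scaled[OF assms] p by (intro mult_left_mono add_mono lin_mono bil_mono order_refl) auto
      then show ?thesis using next_layers_le[OF f p True] super[OF p, of n] by (meson order_trans)
    qed
    ultimately show ?thesis by (simp add: scaled_def scale_def field_simps)
  next
    case False
    then show ?thesis using full nonneg[OF p] by (simp add: entry_outside scale_def)
  qed
  then show ?thesis using full by (simp add: below_def)
qed

text \<open>
  Follow the ray \<open>H + t E\<close> up to the largest \<open>t\<close> at which it is still below \<open>g\<close>. There the inequality
  for \<open>g\<close> is strict in every coordinate, so no coordinate can be attained.
\<close>

lemma below_not_expanding: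
  assumes "below f" "expanding f (diff_layers f (next_layers f))"
  shows False
proof -
  define e where "e = diff_layers f (next_layers f)"
  define E where "E = scaled e"
  define H where "H = scaled f"
  have f: "full f" and nf: "full (next_layers f)"
    using assms(1) below_next_layers by (auto simp: below_def)
  have fe: "full e" unfolding e_def using layer_diff_layers(2)[OF f nf, of 0] by simp
  have H: "0 \<le> H p n" "H p n \<le> g p n" if "p \<le> 2" for p n
    using below_scaled[OF assms(1) that] by (auto simp: H_def)
  have Epos: "0 < E p n" if "p \<le> 2" "n < 11" for p n
    using expanding_iff(1)[OF f fe _ that] assms(2) that fe
    by (simp add: E_def scaled_def entry_inside scale_def e_def)
  have Eout: "E p n = 0" if "n \<ge> 11" for p n
    using that fe by (simp add: E_def scaled_def entry_outside)
  have Enn: "0 \<le> E p n" if "p \<le> 2" for p n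
    using Epos[of p n] Eout[of n p] that by (cases "n < 11") auto
  \<comment> \<open>As \<open>e\<close> is the computed increment, \<open>H + E\<close> is the next
    iterate.\<close>
  have gain: "H p n + E p n \<le> 3 / 26 * (real (catalan (Suc n)) + lin H p n + bil H H p n)"
    if "p \<le> 2" "n < 11" for p n
  proof -
    have "H p n + E p n = scaled (next_layers f) p n"
      using that f nf fe layer_diff_layers(1)[OF f nf that(2), of p]
      by (simp add: H_def E_def scaled_def entry_inside e_def add_divide_distrib[symmetric])
    then show ?thesis using next_layers_le[OF f that] by (simp add: H_def)
  qed
  have growth: "E p n \<le> 3 / 26 * (lin E p n + bil H E p n + bil E H p n)" if "p \<le> 2" "n < 11" for p n
  proof -
    define s where "s = real_of_int scale"
    have s: "s > 0" by (simp add: s_def scale_def)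
    have "26 * scale * layer e p ! n \<le>
      3 * (scale * layer (lin_layers e) p ! n + layer (bil_layers f e) p ! n + layer (bil_layers e f) p ! n)"
      using expanding_iff(2)[OF f fe _ that] assms(2) by (simp add: e_def)
    then have "real_of_int (26 * scale * layer e p ! n) \<le> real_of_int
      (3 * (scale * layer (lin_layers e) p ! n + layer (bil_layers f e) p ! n + layer (bil_layers e f) p ! n))"
      by (simp only: of_int_le_iff)
    then show ?thesis
      using s that f fe unfolding E_def H_def lin_scaled[OF fe that] bil_scaled[OF f fe that] bil_scaled[OF fe f that]
      by (simp add: scaled_def entry_inside s_def[symmetric] field_simps)
  qed
  \<comment> \<open>The parameter at which the ray meets \<open>g\<close> in a given coordinate; for
    \<open>n \<ge> 11\<close> the ray is constant.\<close>
  define R where "R = (\<lambda>(p, n). (g p n - H p n) / E p n)"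
  let ?X = "{..2::nat} \<times> {..<11::nat}"
  have "(0, 0) \<in> ?X" by simp
  then have ne: "finite (R ` ?X)" "R ` ?X \<noteq> {}" by blast+
  define t where "t = Min (R ` ?X)"
  have "t \<in> R ` ?X" unfolding t_def using ne by (rule Min_in)
  then obtain p n where pn: "p \<le> 2" "n < 11" "t = (g p n - H p n) / E p n"
    by (auto simp: R_def)
  have t0: "0 \<le> t" using H[OF pn(1)] Epos[OF pn(1,2)] by (simp add: pn(3))
  have le: "H p n + t * E p n \<le> g p n" if "p \<le> 2" for p n
  proof (cases "n < 11")
    case True
    have "t \<le> R (p, n)" unfolding t_def using that True by (intro Min_le ne) auto
    then show ?thesis using Epos[OF that True] by (simp add: R_def field_simps)
  next
    case False
    then show ?thesis using Eout[of n p] H[OF that] by simp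
  qed
  have eq: "g p n = H p n + t * E p n" using Epos[OF pn(1,2)] by (simp add: pn(3))
  let ?K = "\<lambda>p n. H p n + t * E p n"
  have Knn: "0 \<le> ?K p n" if "p \<le> 2" for p n using H[OF that] Enn[OF that] t0 by simp
  \<comment> \<open>This is \<open>gain\<close> plus \<open>t\<close> times \<open>growth\<close>.
    The right-hand side is the system at \<open>H + t E\<close> without its nonnegative term in
    \<open>t * t\<close>, and the extra \<open>E p n\<close> on the left gives the
    contradiction.\<close>
  have "H p n + E p n + t * E p n \<le>
      3 / 26 * (real (catalan (Suc n)) + lin H p n + bil H H p n) +
      t * (3 / 26 * (lin E p n + bil H E p n + bil E H p n))"
    using gain[OF pn(1,2)] growth[OF pn(1,2)] t0 by (intro add_mono mult_left_mono)
  also have "\<dots> \<le> 3 / 26 * (real (catalan (Suc n)) + lin ?K p n + bil ?K ?K p n)"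
  proof -
    have "0 \<le> t * t * bil E E p n"
      using Enn t0 by (intro mult_nonneg_nonneg bil_nonneg) auto
    then show ?thesis
      unfolding lin_add lin_scale bil_add_left bil_add_right bil_scale_left bil_scale_right
      by (simp add: algebra_simps del: catalan.simps)
  qed
  also have "\<dots> \<le> 3 / 26 * (real (catalan (Suc n)) + lin g p n + bil g g p n)"
    using le Knn pn(1) by (intro mult_left_mono add_mono lin_mono bil_mono order_refl) auto
  also have "\<dots> \<le> g p n" using super[OF pn(1)] .
  finally show False using eq Epos[OF pn(1,2)] by simp
qed

lemma below_not_eventually_expanding:
  "below f \<Longrightarrow> \<not> eventually_expanding k f (next_layers f)"
proof (induction k arbitrary: f)
  case 0
  then show ?case by (metis below_not_expanding eventually_expanding.simps(1))
next
  case (Suc k)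
  then show ?case using Suc.IH[OF below_next_layers] by simp
qed

lemma below_zero_layers: "below zero_layers"
proof -
  have "full zero_layers" by (simp add: full_def zero_layers_def)
  moreover have "entry zero_layers p n = 0" for p n
    by (simp add: entry_def coefs_def layer_def zero_layers_def)
  ultimately show ?thesis using nonneg by (simp add: below_def scale_def)
qed

end

text \<open>By evaluation, the test succeeds at the 21st iterate from zero, with the increment to
  the 22nd as direction.\<close>

lemma zero_layers_expanding: "eventually_expanding 21 zero_layers (next_layers zero_layers)"
  by code_simp

theorem theorem11:
  shows "convergent (\<lambda>n. root n (real (W3 n))) \<and> lim (\<lambda>n. root n (real (W3 n))) \<ge> 8.659702"
proof (intro conjI W3_root_convergent, rule ccontr)
  assume "\<not> lim (\<lambda>n. root n (real (W3 n))) \<ge> 8.659702"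
  then have lim: "lim (\<lambda>n. root n (real (W3 n))) < 8.659702" by simp
  let ?z = "3 / 26 :: real"
  \<comment> \<open>The constant enters here: 8.659702 * 3 / 26 is less than 1.\<close>
  have sm: "summable (\<lambda>m. (real m + 1)\<^sup>2 * real (W3 (m + n)) * ?z ^ m)" for n
    by (rule summable_W3_moment[OF _ _ _ lim]) auto
  \<comment> \<open>The moments increase with the height bound and are bounded by the series
    \<open>sm\<close>.\<close>
  have "convergent (\<lambda>d. moment ?z d p n)" for p n
  proof (rule Bseq_monoseq_convergent)
    show "Bseq (\<lambda>d. moment ?z d p n)"
      using moment_le[OF _ sm] moment_nonneg
      by (intro BseqI'[of _ "\<Sum>m. (real m + 1)\<^sup>2 * real (W3 (m + n)) * ?z ^ m"]) auto
    show "monoseq (\<lambda>d. moment ?z d p n)"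
      by (intro incseq_imp_monoseq incseq_SucI moment_mono) simp
  qed
  then have L: "(\<lambda>d. moment ?z d p n) \<longlonglongrightarrow> lim (\<lambda>d. moment ?z d p n)" for p n
    by (simp add: convergent_LIMSEQ_iff)
  define g where "g = (\<lambda>p n. lim (\<lambda>d. moment ?z d p n))"
  have g: "(\<lambda>d. moment ?z d p n) \<longlonglongrightarrow> g p n" for p n
    using L by (simp add: g_def)
  have conv: "(\<lambda>d. conv (a d) (b d) n) \<longlonglongrightarrow> conv a' b' n"
    if "\<And>n. (\<lambda>d. a d n) \<longlonglongrightarrow> a' n" "\<And>n. (\<lambda>d. b d n) \<longlonglongrightarrow> b' n"
    for a b :: "nat \<Rightarrow> nat \<Rightarrow> real" and a' b' n
    unfolding conv_def by (intro tendsto_intros that)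
  have psum: "(\<lambda>d. psum (moment ?z d) p n) \<longlonglongrightarrow> psum g p n" for p n
    unfolding psum_def by (intro tendsto_intros g)
  have "0 \<le> g p n" for p n
    by (rule LIMSEQ_le_const[OF g]) (use moment_nonneg[of ?z] in auto)
  \<comment> \<open>\<open>moment_Suc_ge\<close> passes to the limit in \<open>d\<close>, since
    \<open>lin\<close> and \<open>bil\<close> are finite sums of products.\<close>
  moreover have "3 / 26 * (real (catalan (Suc n)) + lin g p n + bil g g p n) \<le> g p n" if "p \<le> 2" for p n
  proof (rule LIMSEQ_le[OF _ LIMSEQ_Suc[OF g]])
    have "(\<lambda>d. lin (moment ?z d) p n) \<longlonglongrightarrow> lin g p n"
      unfolding lin_def by (intro tendsto_intros conv psum)
    moreover have "(\<lambda>d. bil (moment ?z d) (moment ?z d) p n) \<longlonglongrightarrow> bil g g p n"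
      unfolding bil_def by (cases "p = 0"; cases "p = 1"; simp; intro tendsto_intros conv psum g)
    ultimately show "(\<lambda>d. 3 / 26 * (real (catalan (Suc n)) + lin (moment ?z d) p n +
        bil (moment ?z d) (moment ?z d) p n)) \<longlonglongrightarrow>
      3 / 26 * (real (catalan (Suc n)) + lin g p n + bil g g p n)"
      by (intro tendsto_intros)
    show "\<exists>N. \<forall>d\<ge>N. 3 / 26 * (real (catalan (Suc n)) + lin (moment ?z d) p n +
        bil (moment ?z d) (moment ?z d) p n) \<le> moment ?z (Suc d) p n"
      using moment_Suc_ge[of ?z p] that by auto
  qed
  ultimately show False
    using below_not_eventually_expanding[OF _ _ below_zero_layers, of g] zero_layers_expanding by blast
qed

end
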